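(* For $n \geq 3$ and sufficiently large $d$, $$\overline{cr}_d\left(K_{d\times n}^d\right) = \Omega\left((8/3)^{d/2}\right)\left(\frac{n}{2}\right)^d\left(\frac{n-1}{2}\right)^d.$$ That is, there exist an absolute constant $c>0$ and an integer $d_0$ such that for all integers $d \geq d_0$ and $n \geq 3$, $\overline{cr}_d\left(K_{d\times n}^d\right) \geq c\,(8/3)^{d/2}\,(n/2)^d\,((n-1)/2)^d$.
   Context: A hypergraph $H=(V,E)$ consists of a vertex set $V$ and a set $E$ of distinct subsets of $V$ called hyperedges; it is $d$-uniform if each hyperedge contains exactly $d$ vertices. $K_{d\times n}^d$ denotes the complete balanced $d$-partite $d$-uniform hypergraph with $n$ vertices in each part: its vertex set is the union of $d$ pairwise disjoint sets $X_1,\ldots,X_d$ with $|X_i|=n$ for each $i$, and its hyperedges are all the $n^d$ sets of $d$ vertices containing exactly one vertex from each $X_i$. A $d$-dimensional rectilinear drawing of a $d$-uniform hypergraph $H=(V,E)$ is an embedding of it in $\mathbb{R}^d$ in which the vertices are represented as (distinct) points in general position (i.e., no $d+1$ vertices lie on a common hyperplane) and each hyperedge is drawn as the $(d-1)$-simplex that is the convex hull of its $d$ vertices. In such a drawing, two hyperedges are crossing if they are vertex disjoint and contain a common point in their relative interiors. The $d$-dimensional rectilinear crossing number $\overline{cr}_d(H)$ is the minimum number of (unordered) crossing pairs of hyperedges among all $d$-dimensional rectilinear drawings of $H$. *)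

theory Defs
  imports "HOL-Analysis.Analysis" "HOL-Analysis.Finite_Function_Topology"
begin

text \<open>
  Since the dimension \<open>d\<close> is quantified inside the statement, \<open>\<real>\<^sup>d\<close> is a carrier set rather than a
  type: the \<open>d\<close>-dimensional coordinate subspace of the normed vector space \<^typ>\<open>nat \<Rightarrow>\<^sub>0 real\<close>.
  The norm of that space restricts to the 1-norm, hence induces the usual topology on \<open>\<real>\<^sup>d\<close>, and
  the carrier is a linear subspace, so \<^const>\<open>convex\<close> hulls, \<^const>\<open>affine\<close> hulls and
  \<^const>\<open>rel_interior\<close> of its subsets are those taken in \<open>\<real>\<^sup>d\<close>.
\<close>

definition real_space :: "nat \<Rightarrow> (nat \<Rightarrow>\<^sub>0 real) set" where
  "real_space d = {x. Poly_Mapping.keys x \<subseteq> {..<d}}"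

definition is_hyperplane :: "nat \<Rightarrow> (nat \<Rightarrow>\<^sub>0 real) set \<Rightarrow> bool" where
  "is_hyperplane d h \<longleftrightarrow>
     (\<exists>a b. (\<exists>i<d. a i \<noteq> 0) \<and>
        h = {x \<in> real_space d. (\<Sum>i<d. a i * Poly_Mapping.lookup x i) = b})"

type_synonym 'v hypergraph = "'v set \<times> 'v set set"

abbreviation hverts :: "'v hypergraph \<Rightarrow> 'v set" where
  "hverts H \<equiv> fst H"

abbreviation hedges :: "'v hypergraph \<Rightarrow> 'v set set" where
  "hedges H \<equiv> snd H"

definition uniform_hypergraph :: "nat \<Rightarrow> 'v hypergraph \<Rightarrow> bool" where
  "uniform_hypergraph d H \<longleftrightarrow> (\<forall>e\<in>hedges H. e \<subseteq> hverts H \<and> card e = d)"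

definition partite_part :: "nat \<Rightarrow> nat \<Rightarrow> (nat \<times> nat) set" where
  "partite_part n i = {i} \<times> {..<n}"

definition complete_partite_hypergraph :: "nat \<Rightarrow> nat \<Rightarrow> (nat \<times> nat) hypergraph" where
  "complete_partite_hypergraph d n =
     (let V = (\<Union>i<d. partite_part n i)
      in (V, {e. e \<subseteq> V \<and> card e = d \<and> (\<forall>i<d. card (e \<inter> partite_part n i) = 1)}))"

text \<open>A drawing is determined by the positions \<open>p\<close> of the vertices.\<close>

definition rectilinear_drawing :: "nat \<Rightarrow> 'v hypergraph \<Rightarrow> ('v \<Rightarrow> (nat \<Rightarrow>\<^sub>0 real)) \<Rightarrow> bool" where
  "rectilinear_drawing d H p \<longleftrightarrow>
     uniform_hypergraph d H \<and>
     p ` hverts H \<subseteq> real_space d \<and>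
     inj_on p (hverts H) \<and>
     (\<forall>S \<subseteq> hverts H. card S = d + 1 \<longrightarrow> \<not> (\<exists>h. is_hyperplane d h \<and> p ` S \<subseteq> h))"

definition drawn_edge :: "('v \<Rightarrow> (nat \<Rightarrow>\<^sub>0 real)) \<Rightarrow> 'v set \<Rightarrow> (nat \<Rightarrow>\<^sub>0 real) set" where
  "drawn_edge p e = convex hull (p ` e)"

definition crossing :: "('v \<Rightarrow> (nat \<Rightarrow>\<^sub>0 real)) \<Rightarrow> 'v set \<Rightarrow> 'v set \<Rightarrow> bool" where
  "crossing p e f \<longleftrightarrow>
     e \<inter> f = {} \<and> rel_interior (drawn_edge p e) \<inter> rel_interior (drawn_edge p f) \<noteq> {}"

definition crossing_pairs :: "'v hypergraph \<Rightarrow> ('v \<Rightarrow> (nat \<Rightarrow>\<^sub>0 real)) \<Rightarrow> 'v set set set" where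
  "crossing_pairs H p = {{e, f} | e f. e \<in> hedges H \<and> f \<in> hedges H \<and> crossing p e f}"

text \<open>
  The infimum of a nonempty set of natural numbers is its minimum. For finite \<open>d\<close>-uniform \<open>H\<close> with
  \<open>d \<ge> 1\<close> drawings exist (place the vertices on the moment curve); without any drawing the value is 0.
\<close>

definition rectilinear_crossing_number :: "nat \<Rightarrow> 'v hypergraph \<Rightarrow> nat" where
  "rectilinear_crossing_number d H =
     Inf {card (crossing_pairs H p) | p. rectilinear_drawing d H p}"

end

theory Submission
  imports Defs "HOL-Library.Z2"
begin

text \<open>
  Only \<open>m = (d + 1) div 2 + 1\<close>, about half, of the \<open>d\<close> parts have to be controlled. Take three
  vertices in each of these \<open>m\<close> parts. By the linear case of the van Kampen--Flores theorem (the
  \<open>m\<close>-fold join of three points does not embed in dimension \<open>2 * m - 2\<close>, which is at least \<open>d\<close>) there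
  are two disjoint transversals of the \<open>m\<close> triples whose convex hulls meet; this is
  \<open>crossing_dependence\<close>, stated for vectors: there is a nonzero linear dependence with at most one
  positive and at most one negative coefficient in each triple. In general position such a
  dependence can be moved a little so that it becomes strictly positive on one given edge and
  strictly negative on another one, as soon as the edges contain its positive and its negative
  vertices (\<open>weak_crossing\<close>). So the two transversals extend to a crossing pair of edges however the
  other \<open>d - m\<close> parts are filled (\<open>crossing_selection\<close>).

  Counting (\<open>card_crossing_choices\<close>): there are \<open>(n choose 3) ^ m\<close> systems of triples, and a pair of
  vertices lies in \<open>n - 2\<close> triples of its part. This gives at least
  \<open>(n * (n - 1) / 6) ^ m * (n * (n - 1)) ^ (d - m) = (n * (n - 1)) ^ d / 6 ^ m\<close> ordered crossing pairs.
  Since \<open>m \<le> d / 2 + 2\<close> and \<open>(8 / 3) powr (1 / 2) / 4 = 6 powr (- 1 / 2)\<close>, this is the claimed bound,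
  with constant \<open>1 / 72\<close>.

  The dependence comes from a Borsuk--Ulam argument. The vectors of \<open>(\<real>\<^sup>3)\<^sup>m\<close> with at most one positive
  and at most one negative coordinate in each triple form the cone over a join of \<open>m\<close> hexagons, which
  is a sphere of dimension \<open>2 * m - 1\<close> with its antipodal map, and \<open>2 * m - 1\<close> linear functionals define an
  odd map on it. That it has a zero is proved by counting modulo 2: for generic functionals, the
  number of zeros of the first \<open>k\<close> functionals on a \<open>k\<close>-dimensional hemisphere has the same parity for
  all \<open>k\<close>. Inside one simplex the zeros of the first \<open>k\<close> functionals form a segment or nothing, so that the
  zeros of the next functional are counted modulo 2 by the ends of the segment at which it is
  positive (\<open>has_zero_parity\<close>). Summed over a hemisphere, interior facets cancel (\<open>join_sum_boundary\<close>), and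
  on the boundary sphere exactly one of two antipodal zeros is positive (\<open>has_zero_antipodal\<close>).
  Arbitrary functionals are limits of generic ones.
\<close>

section \<open>Linear dependences of generic vectors\<close>

text \<open>
  The functionals are indexed by \<open>j\<close>; the vectors are the columns \<open>\<lambda>j. W j v\<close>, of which only the first
  \<open>k\<close> entries are used. The dimension is thus a number, and can be varied in inductions.
\<close>

definition dependence :: "(nat \<Rightarrow> 'v \<Rightarrow> real) \<Rightarrow> nat \<Rightarrow> 'v set \<Rightarrow> ('v \<Rightarrow> real) \<Rightarrow> bool" where
  "dependence W k S x \<longleftrightarrow> (\<forall>j<k. (\<Sum>v\<in>S. x v * W j v) = 0)"

lemma sum_combination:
  fixes x y w :: "'v \<Rightarrow> real"
  shows "(\<Sum>v\<in>S. (a * x v + b * y v) * w v) = a * (\<Sum>v\<in>S. x v * w v) + b * (\<Sum>v\<in>S. y v * w v)"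
  by (simp add: sum_distrib_left sum.distrib algebra_simps)

text \<open>
  With \<open>b = 0\<close> this also serves for scaling, which explains summands of the form \<open>0 * x v\<close> below.
\<close>

lemma dependence_combination:
  assumes "dependence W k S x" "dependence W k S y"
  shows "dependence W k S (\<lambda>v. a * x v + b * y v)"
  using assms by (simp add: dependence_def sum_combination)

lemma dependence_extend:
  assumes "dependence W k T x" "finite S" "T \<subseteq> S" "\<And>v. v \<in> S - T \<Longrightarrow> x v = 0"
  shows "dependence W k S x"
proof -
  have "(\<Sum>v\<in>S. x v * W j v) = (\<Sum>v\<in>T. x v * W j v)" for j
    by (rule sum.mono_neutral_right) (use assms in auto)
  with assms(1) show ?thesis by (simp add: dependence_def)
qed

lemma dependence_restrict:
  assumes "dependence W k S x" "finite S" "T \<subseteq> S" "\<And>v. v \<in> S - T \<Longrightarrow> x v = 0"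
  shows "dependence W k T x"
proof -
  have "(\<Sum>v\<in>S. x v * W j v) = (\<Sum>v\<in>T. x v * W j v)" for j
    by (rule sum.mono_neutral_right) (use assms in auto)
  with assms(1) show ?thesis by (simp add: dependence_def)
qed

text \<open>
  Gaussian elimination: more unknowns than equations.
\<close>

lemma dependence_exists:
  assumes "finite S" "card S > k"
  shows "\<exists>x. dependence W k S x \<and> (\<exists>v\<in>S. x v \<noteq> 0)"
  using assms
proof (induction k arbitrary: S W)
  case 0
  then have "S \<noteq> {}" by auto
  then show ?case by (intro exI[of _ "\<lambda>_. 1"]) (auto simp: dependence_def)
next
  case (Suc k)
  show ?case
  proof (cases "\<forall>u\<in>S. W k u = 0")
    case True
    from Suc obtain x where "dependence W k S x" "\<exists>v\<in>S. x v \<noteq> 0"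
      by (metis Suc_lessD)
    with True show ?thesis by (auto simp: dependence_def less_Suc_eq)
  next
    case False
    then obtain u where u: "u \<in> S" "W k u \<noteq> 0" by auto
    \<comment> \<open>Eliminate the unknown at \<open>u\<close> with the help of equation \<open>k\<close>.\<close>
    define W' where "W' j v = W j v - W j u * (W k v / W k u)" for j v
    have "k < card (S - {u})" using Suc.prems u by simp
    then obtain x where x: "dependence W' k (S - {u}) x" "\<exists>v\<in>S - {u}. x v \<noteq> 0"
      using Suc.IH[of "S - {u}" W'] Suc.prems by auto
    define y where "y = x(u := - (\<Sum>v\<in>S - {u}. x v * (W k v / W k u)))"
    have split: "(\<Sum>v\<in>S. y v * W j v) = (\<Sum>v\<in>S - {u}. x v * W' j v)" for j
    proof -
      have "(\<Sum>v\<in>S. y v * W j v) = y u * W j u + (\<Sum>v\<in>S - {u}. y v * W j v)"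
        using u Suc.prems by (simp add: sum.remove)
      also have "(\<Sum>v\<in>S - {u}. y v * W j v) = (\<Sum>v\<in>S - {u}. x v * W j v)"
        by (rule sum.cong) (auto simp: y_def)
      also have "y u * W j u = - (\<Sum>v\<in>S - {u}. x v * (W j u * (W k v / W k u)))"
        by (simp add: y_def sum_distrib_left sum_distrib_right sum_negf algebra_simps)
      finally show ?thesis
        by (simp add: W'_def sum_subtractf algebra_simps)
    qed
    have "dependence W (Suc k) S y"
      unfolding dependence_def
    proof (intro allI impI)
      fix j assume "j < Suc k"
      then consider "j < k" | "j = k" by linarith
      then show "(\<Sum>v\<in>S. y v * W j v) = 0"
      proof cases
        case 1
        with x show ?thesis by (simp add: split dependence_def)
      next
        case 2
        with u show ?thesis by (simp add: split W'_def)
      qed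
    qed
    moreover have "\<exists>v\<in>S. y v \<noteq> 0"
    proof -
      from x(2) obtain v where "v \<in> S" "v \<noteq> u" "x v \<noteq> 0" by blast
      then show ?thesis by (intro bexI[of _ v]) (simp_all add: y_def)
    qed
    ultimately show ?thesis by blast
  qed
qed

text \<open>
  Any \<open>k \<le> n\<close> of the vectors are linearly independent already in their first \<open>k\<close> entries. This is stronger
  than general position in dimension \<open>n\<close>, because the parity count uses the functionals one by one.
\<close>

definition generic :: "(nat \<Rightarrow> 'v \<Rightarrow> real) \<Rightarrow> nat \<Rightarrow> 'v set \<Rightarrow> bool" where
  "generic W n S \<longleftrightarrow>
     (\<forall>U\<subseteq>S. card U \<le> n \<longrightarrow> (\<forall>x. dependence W (card U) U x \<longrightarrow> (\<forall>v\<in>U. x v = 0)))"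

lemma generic_subset: "generic W n S \<Longrightarrow> T \<subseteq> S \<Longrightarrow> generic W n T"
  unfolding generic_def by blast

lemma generic_vanish:
  assumes "generic W n S" "finite S" "U \<subseteq> S" "card U \<le> k" "k \<le> n"
    "dependence W k S x" "\<And>v. v \<in> S - U \<Longrightarrow> x v = 0" "v \<in> S"
  shows "x v = 0"
proof (cases "v \<in> U")
  case True
  have "dependence W k U x"
    using assms by (intro dependence_restrict[of W k S x U]) auto
  then have "dependence W (card U) U x"
    using assms(4) by (auto simp: dependence_def)
  moreover have "card U \<le> n" using assms(4,5) by linarith
  ultimately show ?thesis
    using assms(1,3) True unfolding generic_def by blast
next
  case False
  with assms show ?thesis by blast
qed

section \<open>Zeros in a simplex and in its facets\<close>

text \<open>
  The linear map given by the first \<open>k\<close> functionals and sending each \<open>v\<close> to its column has a zero in the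
  relative interior of the simplex spanned by \<open>S\<close> (with its cone used in place of the simplex).
\<close>

definition has_zero :: "(nat \<Rightarrow> 'v \<Rightarrow> real) \<Rightarrow> nat \<Rightarrow> 'v set \<Rightarrow> bool" where
  "has_zero W k S \<longleftrightarrow> (\<exists>x. (\<forall>v\<in>S. x v > 0) \<and> dependence W k S x)"

definition has_pos_zero :: "(nat \<Rightarrow> 'v \<Rightarrow> real) \<Rightarrow> nat \<Rightarrow> 'v set \<Rightarrow> bool" where
  "has_pos_zero W k S \<longleftrightarrow>
     (\<exists>x. (\<forall>v\<in>S. x v > 0) \<and> dependence W k S x \<and> (\<Sum>v\<in>S. x v * W k v) > 0)"

text \<open>
  A zero in the interior of the facet of \<open>S\<close> opposite to \<open>r\<close>.
\<close>

definition facet_zero :: "(nat \<Rightarrow> 'v \<Rightarrow> real) \<Rightarrow> nat \<Rightarrow> 'v set \<Rightarrow> 'v \<Rightarrow> ('v \<Rightarrow> real) \<Rightarrow> bool" where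
  "facet_zero W k S r x \<longleftrightarrow>
     r \<in> S \<and> x r = 0 \<and> (\<forall>v\<in>S. v \<noteq> r \<longrightarrow> x v > 0) \<and> dependence W k S x"

locale generic_simplex =
  fixes W :: "nat \<Rightarrow> 'v \<Rightarrow> real" and n k S
  assumes gen: "generic W n S" and fin: "finite S" and card: "card S = k + 2" and kn: "Suc k \<le> n"
begin

text \<open>
  The dependences form a plane, and by genericity no nonzero one of them vanishes at two vertices.
\<close>

lemma two_zeros_vanish:
  assumes "dependence W k S x" "a \<in> S" "b \<in> S" "a \<noteq> b" "x a = 0" "x b = 0" "v \<in> S"
  shows "x v = 0"
proof (rule generic_vanish[OF gen fin _ _ _ assms(1) _ assms(7), of "S - {a, b}"])
  show "card (S - {a, b}) \<le> k"
    using assms card by (subst card_Diff_subset) auto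
qed (use kn assms in auto)

text \<open>
  The ratio test of the simplex method: subtract from \<open>y\<close> the largest multiple of \<open>u\<close> that keeps all
  coefficients nonnegative. The coefficient at \<open>a\<close> does not change, so the result is not zero.
\<close>

lemma decrease_until_zero:
  assumes y: "dependence W k S y" "\<And>v. v \<in> S \<Longrightarrow> y v \<ge> 0" and a: "a \<in> S" "y a > 0"
    and u: "dependence W k S u" "u a = 0" "\<exists>v\<in>S. u v > 0"
    and yu: "\<And>v. v \<in> S \<Longrightarrow> u v > 0 \<Longrightarrow> y v > 0"
  shows "\<exists>r x. facet_zero W k S r x \<and> y r > 0"
proof -
  define Q where "Q = {v \<in> S. u v > 0}"
  have Q: "finite Q" "Q \<noteq> {}" using fin u by (auto simp: Q_def)
  obtain r where r: "r \<in> Q" "\<And>v. v \<in> Q \<Longrightarrow> y r / u r \<le> y v / u v"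
    using ex_is_arg_min_if_finite[OF Q, of "\<lambda>v. y v / u v"] by (auto simp: is_arg_min_linorder)
  define t where "t = y r / u r"
  have ur: "r \<in> S" "u r > 0" "y r > 0" using r yu by (auto simp: Q_def)
  then have t: "t > 0" by (simp add: t_def)
  define x where "x v = 1 * y v + (- t) * u v" for v
  have x: "dependence W k S x"
    unfolding x_def by (rule dependence_combination) (use y u in auto)
  have xr: "x r = 0" using ur by (simp add: x_def t_def)
  have xa: "x a > 0" using a u by (simp add: x_def)
  have nonneg: "x v \<ge> 0" if "v \<in> S" for v
  proof (cases "u v > 0")
    case True
    with that r(2)[of v] have "t \<le> y v / u v" by (simp add: Q_def t_def)
    with True show ?thesis by (simp add: x_def pos_le_divide_eq)
  next
    case False
    with t have "t * u v \<le> 0" by (simp add: mult_le_0_iff)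
    with y(2)[OF that] show ?thesis by (simp add: x_def)
  qed
  have "x v > 0" if "v \<in> S - {r}" for v
  proof (rule ccontr)
    assume "\<not> x v > 0"
    with nonneg[of v] that have "x v = 0" by force
    with two_zeros_vanish[OF x, of r v a] xr xa that ur a show False by auto
  qed
  with x xr ur show ?thesis unfolding facet_zero_def by blast
qed

lemma exists_dependence_with_zero_at:
  assumes "w \<in> S" "v \<in> S" "v \<noteq> w"
  shows "\<exists>u. dependence W k S u \<and> u w = 0 \<and> u v = 1"
proof -
  have "card (S - {w}) > k" using assms card by simp
  from dependence_exists[OF _ this] fin obtain u' where
    u': "dependence W k (S - {w}) u'" "\<exists>v\<in>S-{w}. u' v \<noteq> 0" by blast
  define u where "u = u'(w := 0)"
  have "dependence W k (S - {w}) u"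
    using u'(1) unfolding dependence_def u_def by (simp cong: sum.cong_simp)
  then have u: "dependence W k S u"
    by (rule dependence_extend) (use fin in \<open>auto simp: u_def\<close>)
  have uw: "u w = 0" by (simp add: u_def)
  have "u v \<noteq> 0"
  proof
    assume "u v = 0"
    with two_zeros_vanish[OF u, of w v] uw assms have "\<forall>v'\<in>S. u v' = 0" by blast
    moreover from u'(2) obtain z where "z \<in> S" "z \<noteq> w" "u' z \<noteq> 0" by blast
    ultimately show False by (auto simp: u_def)
  qed
  moreover have "dependence W k S (\<lambda>z. (1 / u v) * u z + 0 * u z)"
    by (rule dependence_combination) (use u in auto)
  ultimately show ?thesis using uw by (intro exI[of _ "\<lambda>z. (1 / u v) * u z + 0 * u z"]) auto
qed

lemma exists_other_vertex: "\<exists>v\<in>S. v \<noteq> r"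
proof (rule ccontr)
  assume "\<not> ?thesis"
  then have "S \<subseteq> {r}" by auto
  then have "card S \<le> 1" using card_mono[of "{r}" S] by simp
  with card show False by simp
qed

text \<open>
  The solution set in the simplex is a segment: it leaves through a second facet.
\<close>

lemma another_facet_zero:
  assumes x: "facet_zero W k S r x"
  shows "\<exists>s z. s \<noteq> r \<and> facet_zero W k S s z"
proof -
  have r: "r \<in> S" "x r = 0" "\<And>v. v \<in> S \<Longrightarrow> v \<noteq> r \<Longrightarrow> x v > 0" "dependence W k S x"
    using x by (auto simp: facet_zero_def)
  obtain a where a: "a \<in> S" "a \<noteq> r" using exists_other_vertex r by blast
  obtain u where u: "dependence W k S u" "u a = 0" "u r = 1"
    using exists_dependence_with_zero_at[of a r] a r by auto
  show ?thesis
  proof (cases "\<exists>v\<in>S. u v < 0")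
    case True
    define u' where "u' v = (-1) * u v + 0 * u v" for v
    have "dependence W k S u'" unfolding u'_def by (rule dependence_combination) (use u in auto)
    then have "\<exists>s z. facet_zero W k S s z \<and> x s > 0"
    proof (rule decrease_until_zero[rotated 4])
      show "dependence W k S x" "a \<in> S" "x a > 0" using r a by auto
      show "x v \<ge> 0" if "v \<in> S" for v
        using r(2) r(3)[of v] that by (cases "v = r") (auto simp: less_imp_le)
      show "u' a = 0" "\<exists>v\<in>S. u' v > 0" using True u by (auto simp: u'_def)
      show "x v > 0" if "v \<in> S" "u' v > 0" for v
        using r(3)[of v] that u(3) by (cases "v = r") (auto simp: u'_def)
    qed
    with r(2) show ?thesis by (metis less_irrefl)
  next
    case False
    have "u v > 0" if "v \<in> S - {a}" for v
    proof (rule ccontr)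
      assume "\<not> u v > 0"
      with False that have "u v = 0" by force
      with two_zeros_vanish[OF u(1), of a v r] u r a that show False by auto
    qed
    with u a have "facet_zero W k S a u" by (auto simp: facet_zero_def)
    with a show ?thesis by blast
  qed
qed

lemma facet_zero_from_interior:
  assumes y: "\<And>v. v \<in> S \<Longrightarrow> y v > 0" "dependence W k S y"
  shows "\<exists>r x. facet_zero W k S r x"
proof -
  obtain a b where ab: "a \<in> S" "b \<in> S" "b \<noteq> a"
    using exists_other_vertex by blast
  obtain u where u: "dependence W k S u" "u a = 0" "u b = 1"
    using exists_dependence_with_zero_at[of a b] ab by auto
  have "\<exists>r x. facet_zero W k S r x \<and> y r > 0"
    by (rule decrease_until_zero[of y a u]) (use y ab u in \<open>auto simp: less_imp_le intro: bexI[of _ b]\<close>)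
  then show ?thesis by blast
qed

lemma combination_of_two:
  assumes "facet_zero W k S r x" "facet_zero W k S s z" "r \<noteq> s" "dependence W k S u" "v \<in> S"
  shows "u v = (u s / x s) * x v + (u r / z r) * z v"
proof -
  have rs: "r \<in> S" "s \<in> S" "x r = 0" "z s = 0" "x s > 0" "z r > 0"
    using assms by (auto simp: facet_zero_def)
  define q where "q v = 1 * u v + (-1) * ((u s / x s) * x v + (u r / z r) * z v)" for v
  have "dependence W k S q" unfolding q_def
    by (intro dependence_combination) (use assms in \<open>auto simp: facet_zero_def\<close>)
  then have "q v = 0"
    using two_zeros_vanish[of q r s v] assms rs by (auto simp: q_def)
  then show ?thesis by (simp add: q_def)
qed

text \<open>
  In the plane of dependences, the third solution is a combination of the first two whose
  coefficients are read off at \<open>r\<close> and \<open>s\<close> and are positive; so it cannot vanish at a third vertex.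
\<close>

lemma facet_zero_indices:
  assumes x: "facet_zero W k S r x" and z: "facet_zero W k S s z" and rs: "r \<noteq> s"
    and u: "facet_zero W k S t u"
  shows "t = r \<or> t = s"
proof (rule ccontr)
  assume t: "\<not> ?thesis"
  have pos: "u s > 0" "u r > 0" "x s > 0" "z r > 0" "x t > 0" "z t > 0" "t \<in> S"
    using x z u rs t by (auto simp: facet_zero_def)
  have "u t = (u s / x s) * x t + (u r / z r) * z t"
    by (rule combination_of_two[OF x z rs]) (use u in \<open>auto simp: facet_zero_def\<close>)
  with pos have "u t > 0" by (simp add: add_pos_pos)
  with u show False by (simp add: facet_zero_def)
qed

definition value_at :: "('v \<Rightarrow> real) \<Rightarrow> real" where
  "value_at x = (\<Sum>v\<in>S. x v * W k v)"

lemma value_combination: "value_at (\<lambda>v. a * x v + b * y v) = a * value_at x + b * value_at y"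
  by (simp add: value_at_def sum_combination)

lemma dependence_Suc: "dependence W (Suc k) S x \<longleftrightarrow> dependence W k S x \<and> value_at x = 0"
  by (auto simp: dependence_def value_at_def less_Suc_eq)

lemma value_facet_zero:
  assumes "facet_zero W k S r x"
  shows "value_at x \<noteq> 0"
proof
  assume "value_at x = 0"
  with assms have d: "dependence W (Suc k) S x" by (simp add: dependence_Suc facet_zero_def)
  obtain v where v: "v \<in> S" "v \<noteq> r" using exists_other_vertex assms by (auto simp: facet_zero_def)
  have "x v = 0"
    by (rule generic_vanish[OF gen fin _ _ _ d _ v(1), of "S - {r}"])
      (use assms card kn in \<open>auto simp: facet_zero_def\<close>)
  with assms v show False by (auto simp: facet_zero_def)
qed

lemma has_pos_zero_facet:
  assumes "r \<in> S"
  shows "has_pos_zero W k (S - {r}) \<longleftrightarrow> (\<exists>x. facet_zero W k S r x \<and> value_at x > 0)"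
proof
  assume "has_pos_zero W k (S - {r})"
  then obtain x where x: "\<forall>v\<in>S - {r}. x v > 0" "dependence W k (S - {r}) x"
    "(\<Sum>v\<in>S - {r}. x v * W k v) > 0" unfolding has_pos_zero_def by blast
  define y where "y = x(r := 0)"
  have "dependence W k (S - {r}) y"
    using x(2) unfolding dependence_def y_def by (simp cong: sum.cong_simp)
  then have "dependence W k S y"
    by (rule dependence_extend) (use fin in \<open>auto simp: y_def\<close>)
  moreover have "value_at y = (\<Sum>v\<in>S - {r}. x v * W k v)"
    unfolding value_at_def using fin assms
    by (simp add: sum.remove y_def cong: sum.cong_simp)
  ultimately show "\<exists>x. facet_zero W k S r x \<and> value_at x > 0"
    using x(1,3) assms by (intro exI[of _ y]) (auto simp: facet_zero_def y_def)
next
  assume "\<exists>x. facet_zero W k S r x \<and> value_at x > 0"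
  then obtain x where x: "facet_zero W k S r x" "value_at x > 0" by blast
  then have xr: "dependence W k S x" "x r = 0" by (auto simp: facet_zero_def)
  from xr(1) have "dependence W k (S - {r}) x"
    by (rule dependence_restrict) (use fin xr(2) in auto)
  moreover have "value_at x = (\<Sum>v\<in>S - {r}. x v * W k v)"
    unfolding value_at_def using fin assms x by (simp add: sum.remove facet_zero_def)
  ultimately show "has_pos_zero W k (S - {r})"
    using x unfolding has_pos_zero_def by (intro exI[of _ x]) (simp add: facet_zero_def)
qed

lemma value_sign_unique:
  assumes x: "facet_zero W k S r x" and y: "facet_zero W k S r y" and "value_at x > 0"
  shows "value_at y > 0"
proof -
  obtain s z where z: "s \<noteq> r" "facet_zero W k S s z" using another_facet_zero[OF x] by blast
  have yr: "y r = 0" and pos: "y s > 0" "x s > 0" using x y z by (auto simp: facet_zero_def)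
  have "y v = (y s / x s) * x v" if "v \<in> S" for v
    using combination_of_two[OF x z(2) _ _ that, of y] z y yr by (auto simp: facet_zero_def)
  then have "value_at y = (y s / x s) * value_at x"
    by (simp add: value_at_def sum_distrib_left mult.assoc cong: sum.cong_simp)
  with pos assms show ?thesis by simp
qed

text \<open>
  The solutions for the first \<open>k\<close> functionals form a segment with ends in two facets, or there are none.
  The next functional vanishes inside the segment iff its signs at the two ends differ, that is, iff it
  is positive at exactly one end.
\<close>

lemma has_zero_parity:
  "of_bool (has_zero W (Suc k) S) = (\<Sum>v\<in>S. of_bool (has_pos_zero W k (S - {v})) :: bit)"
proof (cases "\<exists>r x. facet_zero W k S r x")
  case False
  then have "\<not> has_zero W (Suc k) S"
    unfolding has_zero_def dependence_Suc using facet_zero_from_interior by blast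
  moreover have "\<not> has_pos_zero W k (S - {v})" if "v \<in> S" for v
    using False has_pos_zero_facet that by blast
  ultimately show ?thesis by simp
next
  case True
  then obtain r x where x: "facet_zero W k S r x" by blast
  obtain s z where z: "s \<noteq> r" "facet_zero W k S s z" using another_facet_zero[OF x] by blast
  have rs: "r \<in> S" "s \<in> S" "x r = 0" "z s = 0" "x s > 0" "z r > 0"
    using x z by (auto simp: facet_zero_def)
  have pos_r: "has_pos_zero W k (S - {r}) \<longleftrightarrow> value_at x > 0"
    using has_pos_zero_facet[OF rs(1)] value_sign_unique x by blast
  have pos_s: "has_pos_zero W k (S - {s}) \<longleftrightarrow> value_at z > 0"
    using has_pos_zero_facet[OF rs(2)] value_sign_unique z by blast
  have other: "\<not> has_pos_zero W k (S - {v})" if "v \<in> S - {r, s}" for v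
    using has_pos_zero_facet[of v] facet_zero_indices[OF x z(2)] z that by auto
  have "(\<Sum>v\<in>S. of_bool (has_pos_zero W k (S - {v})) :: bit)
      = (\<Sum>v\<in>{r, s}. of_bool (has_pos_zero W k (S - {v})))"
    by (rule sum.mono_neutral_right) (use fin rs other in auto)
  also have "\<dots> = of_bool (value_at x > 0) + of_bool (value_at z > 0)"
    using z(1) pos_r pos_s by (simp del: sum_of_bool_eq)
  also have "\<dots> = of_bool (has_zero W (Suc k) S)"
  proof -
    have "has_zero W (Suc k) S \<longleftrightarrow> (value_at x > 0) \<noteq> (value_at z > 0)"
    proof
      assume "has_zero W (Suc k) S"
      then obtain y where y: "\<forall>v\<in>S. y v > 0" "dependence W k S y" "value_at y = 0"
        unfolding has_zero_def dependence_Suc by blast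
      \<comment> \<open>The point \<open>y\<close> of the segment between \<open>x\<close> and \<open>z\<close> is a positive combination of its ends.\<close>
      define a b where "a = y s / x s" and "b = y r / z r"
      have ab: "a > 0" "b > 0" using y rs by (auto simp: a_def b_def)
      have "y v = a * x v + b * z v" if "v \<in> S" for v
        using combination_of_two[OF x z(2) _ y(2) that] z by (simp add: a_def b_def)
      then have "value_at y = value_at (\<lambda>v. a * x v + b * z v)"
        by (simp add: value_at_def cong: sum.cong_simp)
      then have eq: "a * value_at x + b * value_at z = 0" using y by (simp add: value_combination)
      with ab have "value_at z = - ((a / b) * value_at x)" by (simp add: field_simps)
      with ab value_facet_zero[OF x] show "(value_at x > 0) \<noteq> (value_at z > 0)"
        by (auto simp: zero_less_mult_iff divide_less_0_iff mult_less_0_iff)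
    next
      assume ne: "(value_at x > 0) \<noteq> (value_at z > 0)"
      \<comment> \<open>These weights make the next functional vanish, since its values at \<open>x\<close> and \<open>z\<close> have opposite signs.\<close>
      define a b where "a = \<bar>value_at z\<bar>" and "b = \<bar>value_at x\<bar>"
      have ab: "a > 0" "b > 0"
        using value_facet_zero[OF x] value_facet_zero[OF z(2)] by (auto simp: a_def b_def)
      have "a * value_at x + b * value_at z = 0" using ne by (auto simp: a_def b_def abs_if)
      then have "dependence W (Suc k) S (\<lambda>v. a * x v + b * z v)"
        unfolding dependence_Suc value_combination
        using dependence_combination x z unfolding facet_zero_def by blast
      moreover have "a * x v + b * z v > 0" if "v \<in> S" for v
      proof (cases "v = r")
        case True
        with ab rs show ?thesis by simp
      next
        case False
        then have "x v > 0" "z v \<ge> 0"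
          using x z that by (cases "v = s"; force simp: facet_zero_def)+
        with ab show ?thesis by (simp add: add_pos_nonneg)
      qed
      ultimately show "has_zero W (Suc k) S"
        unfolding has_zero_def by (intro exI[of _ "\<lambda>v. a * x v + b * z v"]) simp
    qed
    then show ?thesis by auto
  qed
  finally show ?thesis by simp
qed

end

declare add_bit_eq_xor [simp del]

lemma bit_self_add [simp]: "a + a = (0::bit)"
  by (cases a) auto

text \<open>
  Genericity makes the next functional nonzero at the zero; it is positive either there or at the
  antipode.
\<close>

lemma has_zero_antipodal:
  assumes gen: "generic W n T" and fin: "finite T" and card: "card T = Suc k" and kn: "Suc k \<le> n"
    and inv: "\<And>v. v \<in> T \<Longrightarrow> neg (neg v) = v" and W: "\<And>j v. v \<in> T \<Longrightarrow> W j (neg v) = - W j v"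
  shows "of_bool (has_zero W k T) = (of_bool (has_pos_zero W k T) + of_bool (has_pos_zero W k (neg ` T)) :: bit)"
proof -
  have inj: "inj_on neg T" by (metis inj_onI inv)
  have reindex: "(\<Sum>v\<in>neg ` T. x v * W j v) = - (\<Sum>v\<in>T. x (neg v) * W j v)" for x j
    by (simp add: sum.reindex[OF inj] W sum_negf)
  have neg_zero: "has_pos_zero W k (neg ` T) \<longleftrightarrow>
    (\<exists>x. (\<forall>v\<in>T. x v > 0) \<and> dependence W k T x \<and> (\<Sum>v\<in>T. x v * W k v) < 0)" (is "?L \<longleftrightarrow> ?R")
  proof
    assume ?L
    then obtain x where "\<forall>v\<in>neg ` T. x v > 0" "dependence W k (neg ` T) x"
      "(\<Sum>v\<in>neg ` T. x v * W k v) > 0" unfolding has_pos_zero_def by blast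
    then show ?R
      by (intro exI[of _ "\<lambda>v. x (neg v)"]) (simp add: dependence_def reindex)
  next
    assume ?R
    then obtain x where x: "\<forall>v\<in>T. x v > 0" "dependence W k T x" "(\<Sum>v\<in>T. x v * W k v) < 0" by blast
    then show ?L unfolding has_pos_zero_def
      by (intro exI[of _ "\<lambda>v. x (neg v)"]) (simp add: dependence_def reindex inv)
  qed
  have nonzero: "(\<Sum>v\<in>T. x v * W k v) \<noteq> 0" if "\<forall>v\<in>T. x v > 0" "dependence W k T x" for x
  proof
    assume "(\<Sum>v\<in>T. x v * W k v) = 0"
    with that(2) have d: "dependence W (Suc k) T x" by (auto simp: dependence_def less_Suc_eq)
    from card obtain v where v: "v \<in> T" by fastforce
    have "x v = 0"
      by (rule generic_vanish[OF gen fin subset_refl _ kn d _ v]) (use card in auto)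
    with that(1) v show False by auto
  qed
  have "\<not> (has_pos_zero W k T \<and> has_pos_zero W k (neg ` T))"
  proof
    assume "has_pos_zero W k T \<and> has_pos_zero W k (neg ` T)"
    then obtain x y where x: "\<forall>v\<in>T. x v > 0" "dependence W k T x" "(\<Sum>v\<in>T. x v * W k v) > 0"
      and y: "\<forall>v\<in>T. y v > 0" "dependence W k T y" "(\<Sum>v\<in>T. y v * W k v) < 0"
      unfolding neg_zero by (auto simp: has_pos_zero_def)
    \<comment> \<open>Zeros with a positive and with a negative value would combine to one at which the value is zero.\<close>
    define a b where "a = - (\<Sum>v\<in>T. y v * W k v)" and "b = (\<Sum>v\<in>T. x v * W k v)"
    have "a > 0" "b > 0" using x y by (auto simp: a_def b_def)
    then have "\<forall>v\<in>T. a * x v + b * y v > 0" using x y by (auto intro: add_pos_pos)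
    moreover have "dependence W k T (\<lambda>v. a * x v + b * y v)"
      using x y by (intro dependence_combination)
    moreover have "(\<Sum>v\<in>T. (a * x v + b * y v) * W k v) = a * b + b * (- a)"
      unfolding sum_combination by (simp add: a_def b_def)
    ultimately show False using nonzero[of "\<lambda>v. a * x v + b * y v"] by simp
  qed
  moreover have "has_zero W k T \<longleftrightarrow> has_pos_zero W k T \<or> has_pos_zero W k (neg ` T)"
  proof
    assume "has_zero W k T"
    then obtain x where x: "\<forall>v\<in>T. x v > 0" "dependence W k T x" unfolding has_zero_def by blast
    with nonzero consider "(\<Sum>v\<in>T. x v * W k v) > 0" | "(\<Sum>v\<in>T. x v * W k v) < 0"
      using less_linear by blast
    then show "has_pos_zero W k T \<or> has_pos_zero W k (neg ` T)"
      unfolding neg_zero by cases (use x in \<open>auto simp: has_pos_zero_def\<close>)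
  next
    assume "has_pos_zero W k T \<or> has_pos_zero W k (neg ` T)"
    then show "has_zero W k T"
      unfolding neg_zero by (auto simp: has_pos_zero_def has_zero_def)
  qed
  ultimately show ?thesis by auto
qed

section \<open>The join of hexagons\<close>

text \<open>
  The hexagon of block \<open>i\<close> has vertices \<open>(i, h)\<close> with \<open>h < 6\<close>, where \<open>(i, h)\<close> stands for the vector
  \<open>(- 1) ^ h\<close> times the unit vector number \<open>h mod 3\<close>. Neighbours have opposite signs and different
  indices, and \<open>h\<close> and \<open>(h + 3) mod 6\<close> are antipodal.
\<close>

definition hex_edge :: "nat \<Rightarrow> nat \<Rightarrow> (nat \<times> nat) set" where
  "hex_edge i h = {(i, h), (i, (h + 1) mod 6)}"

definition antipode :: "nat \<times> nat \<Rightarrow> nat \<times> nat" where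
  "antipode v = (fst v, (snd v + 3) mod 6)"

inductive join_facet :: "nat \<Rightarrow> (nat \<times> nat) set \<Rightarrow> bool" where
  "join_facet 0 {}"
| "join_facet i F \<Longrightarrow> h < 6 \<Longrightarrow> join_facet (Suc i) (F \<union> hex_edge i h)"

text \<open>
  Sum over the facets \<open>F\<close> with \<open>join_facet i F\<close>. Summing over the edges block by block avoids
  having to show that different choices of edges give different facets.
\<close>

fun join_sum :: "nat \<Rightarrow> ((nat \<times> nat) set \<Rightarrow> bit) \<Rightarrow> bit" where
  "join_sum 0 f = f {}"
| "join_sum (Suc i) f = (\<Sum>h<6. join_sum i (\<lambda>F. f (F \<union> hex_edge i h)))"

text \<open>
  A positive combination of the signed vectors of a balanced set has at most one positive and at most
  one negative coordinate in each block.
\<close>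

definition balanced :: "(nat \<times> nat) set \<Rightarrow> bool" where
  "balanced F \<longleftrightarrow> (\<forall>u\<in>F. \<forall>v\<in>F. u \<noteq> v \<longrightarrow> fst u = fst v \<longrightarrow>
     (even (snd u) \<longleftrightarrow> odd (snd v)) \<and> snd u mod 3 \<noteq> snd v mod 3)"

lemma less_6_cases: "h < (6::nat) \<Longrightarrow> h \<in> {0, 1, 2, 3, 4, 5}"
  by auto

lemma join_facet_sub: "join_facet i F \<Longrightarrow> F \<subseteq> {..<i} \<times> {..<6}"
  by (induction rule: join_facet.induct) (auto simp: hex_edge_def)

lemma join_facet_finite: "join_facet i F \<Longrightarrow> finite F"
  by (induction rule: join_facet.induct) (auto simp: hex_edge_def)

lemma hex_edge_ends: "h < (6::nat) \<Longrightarrow> (h + 1) mod 6 \<noteq> h"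
  using less_6_cases[of h] by auto

lemma join_facet_card: "join_facet i F \<Longrightarrow> card F = 2 * i"
proof (induction rule: join_facet.induct)
  case (2 i F h)
  have "F \<inter> hex_edge i h = {}"
    using join_facet_sub[OF 2(1)] by (auto simp: hex_edge_def)
  moreover have "card (hex_edge i h) = 2" using hex_edge_ends[OF 2(2)] by (simp add: hex_edge_def)
  ultimately show ?case
    using 2 join_facet_finite[OF 2(1)] by (subst card_Un_disjoint) (auto simp: hex_edge_def)
qed simp

lemma join_facet_balanced: "join_facet i F \<Longrightarrow> balanced F"
proof (induction rule: join_facet.induct)
  case 1
  show ?case by (simp add: balanced_def)
next
  case (2 i F h)
  have "fst u < i" if "u \<in> F" for u using join_facet_sub[OF 2(1)] that by auto
  moreover have "balanced (hex_edge i h)"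
    using less_6_cases[OF 2(2)] by (auto simp: hex_edge_def balanced_def)
  moreover have "fst u = i" if "u \<in> hex_edge i h" for u using that by (auto simp: hex_edge_def)
  ultimately show ?case using 2(3) unfolding balanced_def by (metis Un_iff less_irrefl)
qed

lemma join_sum_cong:
  "(\<And>F. join_facet i F \<Longrightarrow> f F = g F) \<Longrightarrow> join_sum i f = join_sum i g"
proof (induction i arbitrary: f g)
  case 0
  then show ?case by (simp add: join_facet.intros)
next
  case (Suc i)
  show ?case
    by (auto intro!: sum.cong Suc.IH Suc.prems join_facet.intros)
qed

lemma join_sum_add: "join_sum i (\<lambda>F. f F + g F) = join_sum i f + join_sum i g"
  by (induction i arbitrary: f g) (simp_all add: sum.distrib)

lemma join_sum_zero: "join_sum i (\<lambda>F. 0) = 0"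
  by (induction i) simp_all

lemma sum_less_6: "(\<Sum>h<(6::nat). f h) = f 0 + f 1 + f 2 + f 3 + f 4 + f 5"
  by (simp add: eval_nat_numeral)

lemma sum_less_3: "(\<Sum>h<(3::nat). f h) = f 0 + f 1 + f 2"
  by (simp add: eval_nat_numeral)

lemma sum_rotate:
  assumes "k \<le> 6"
  shows "(\<Sum>h<6. f ((h + k) mod 6)) = (\<Sum>h<(6::nat). f h)"
proof -
  obtain l where l: "k + l = 6" "l + k = 6" using assms by (metis add.commute le_Suc_ex)
  show ?thesis
    by (rule sum.reindex_bij_witness[of _ "\<lambda>h. (h + l) mod 6" "\<lambda>h. (h + k) mod 6"])
      (auto simp: mod_simps add.assoc l)
qed

lemma antipode_hex_edge: "antipode ` hex_edge i h = hex_edge i ((h + 3) mod 6)"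
  by (simp add: hex_edge_def antipode_def mod_simps add.commute)

lemma join_sum_antipode: "join_sum i (\<lambda>F. f (antipode ` F)) = join_sum i f"
proof (induction i arbitrary: f)
  case (Suc i)
  have "join_sum i (\<lambda>F. f (antipode ` F \<union> hex_edge i h)) = join_sum i (\<lambda>F. f (F \<union> hex_edge i h))" for h
    by (rule Suc)
  then show ?case
    using sum_rotate[of 3 "\<lambda>h. join_sum i (\<lambda>F. f (F \<union> hex_edge i h))"]
    by (simp add: image_Un antipode_hex_edge)
qed simp

lemma sum_facets_join:
  assumes "join_facet i F" "h < 6"
  shows "(\<Sum>v\<in>F \<union> hex_edge i h. f (F \<union> hex_edge i h - {v})) =
    (\<Sum>v\<in>F. f (F - {v} \<union> hex_edge i h)) + f (insert (i, h) F) + (f (insert (i, (h + 1) mod 6) F) :: bit)"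
proof -
  have disj: "F \<inter> hex_edge i h = {}"
    using join_facet_sub[OF assms(1)] by (auto simp: hex_edge_def)
  note ne = hex_edge_ends[OF assms(2)]
  have "(\<Sum>v\<in>F \<union> hex_edge i h. f (F \<union> hex_edge i h - {v})) =
    (\<Sum>v\<in>F. f (F \<union> hex_edge i h - {v})) + (\<Sum>v\<in>hex_edge i h. f (F \<union> hex_edge i h - {v}))"
    using disj join_facet_finite[OF assms(1)] by (intro sum.union_disjoint) (auto simp: hex_edge_def)
  also have "(\<Sum>v\<in>F. f (F \<union> hex_edge i h - {v})) = (\<Sum>v\<in>F. f (F - {v} \<union> hex_edge i h))"
    using disj by (intro sum.cong refl arg_cong[where f = f]) auto
  also have "(\<Sum>v\<in>hex_edge i h. f (F \<union> hex_edge i h - {v})) =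
      f (F \<union> hex_edge i h - {(i, h)}) + f (F \<union> hex_edge i h - {(i, (h + 1) mod 6)})"
    using ne by (simp add: hex_edge_def)
  also have "F \<union> hex_edge i h - {(i, h)} = insert (i, (h + 1) mod 6) F"
    using disj ne by (auto simp: hex_edge_def)
  also have "F \<union> hex_edge i h - {(i, (h + 1) mod 6)} = insert (i, h) F"
    using disj ne by (auto simp: hex_edge_def)
  finally show ?thesis by (simp add: add_ac)
qed

text \<open>
  The join is a closed pseudomanifold: each ridge lies in two facets, so the sum over all pairs of a
  facet and one of its ridges is even.
\<close>

lemma join_sum_boundary: "join_sum i (\<lambda>F. \<Sum>v\<in>F. f (F - {v})) = 0"
proof (induction i arbitrary: f)
  case (Suc i)
  define g where "g h = join_sum i (\<lambda>F. f (insert (i, h) F))" for h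
  have "join_sum i (\<lambda>F. \<Sum>v\<in>F \<union> hex_edge i h. f (F \<union> hex_edge i h - {v})) = g h + g ((h + 1) mod 6)"
    if "h < 6" for h
  proof -
    have "join_sum i (\<lambda>F. \<Sum>v\<in>F \<union> hex_edge i h. f (F \<union> hex_edge i h - {v}))
      = join_sum i (\<lambda>F. (\<Sum>v\<in>F. f (F - {v} \<union> hex_edge i h)) + f (insert (i, h) F)
          + f (insert (i, (h + 1) mod 6) F))"
      by (rule join_sum_cong) (rule sum_facets_join[OF _ that])
    also have "\<dots> = g h + g ((h + 1) mod 6)"
      by (simp add: join_sum_add Suc[of "\<lambda>F. f (F \<union> hex_edge i h)"] g_def)
    finally show ?thesis .
  qed
  then have "join_sum (Suc i) (\<lambda>F. \<Sum>v\<in>F. f (F - {v})) = (\<Sum>h<6. g h + g ((h + 1) mod 6))"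
    by simp
  also have "\<dots> = 0"
    unfolding sum.distrib using sum_rotate[of 1 g] by simp
  finally show ?case .
qed simp

section \<open>Parity of the number of zeros on hemispheres\<close>

locale antipodal_map =
  fixes W :: "nat \<Rightarrow> nat \<times> nat \<Rightarrow> real" and m :: nat
  assumes antipodal: "\<And>j v. snd v < 6 \<Longrightarrow> W j (antipode v) = - W j v"
    and gen: "\<And>i F. i \<le> m \<Longrightarrow> join_facet i F \<Longrightarrow> generic W (2 * m - 1) F"
begin

text \<open>
  The cones \<open>insert (i, 0) F\<close> are the facets of a hemisphere of dimension \<open>2 * i\<close>, and the joins of \<open>F\<close> with one
  of the first three edges of hexagon \<open>i\<close> those of a hemisphere of dimension \<open>2 * i + 1\<close>. The boundary of
  each hemisphere is the union of the preceding one with its antipode.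
\<close>

definition even_count :: "nat \<Rightarrow> bit" where
  "even_count i = join_sum i (\<lambda>F. of_bool (has_zero W (2 * i) (insert (i, 0) F)))"

definition odd_count :: "nat \<Rightarrow> bit" where
  "odd_count i = (\<Sum>h<3. join_sum i (\<lambda>F. of_bool (has_zero W (Suc (2 * i)) (F \<union> hex_edge i h))))"

lemma antipode_antipode: "snd v < 6 \<Longrightarrow> antipode (antipode v) = v"
  by (cases v) (simp add: antipode_def mod_simps)

text \<open>
  Among the facets of the first three edges of the hexagon, the two middle vertices occur twice and
  cancel. The remaining vertices \<open>0\<close> and \<open>3\<close> are antipodal.
\<close>

lemma odd_count_eq:
  assumes "i < m"
  shows "odd_count i = even_count i"
proof -
  let ?P = "\<lambda>T. of_bool (has_pos_zero W (2 * i) T) :: bit"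
  define g where "g h = join_sum i (\<lambda>F. ?P (insert (i, h) F))" for h
  have summand: "join_sum i (\<lambda>F. of_bool (has_zero W (Suc (2 * i)) (F \<union> hex_edge i h))) = g h + g (h + 1)"
    if h: "h < 3" for h
  proof -
    have h6: "h < 6" and hmod: "(h + 1) mod 6 = h + 1" using h by auto
    have "of_bool (has_zero W (Suc (2 * i)) (F \<union> hex_edge i h)) =
        (\<Sum>v\<in>F. ?P (F - {v} \<union> hex_edge i h)) + ?P (insert (i, h) F) + ?P (insert (i, h + 1) F)"
      if F: "join_facet i F" for F
    proof -
      have F': "join_facet (Suc i) (F \<union> hex_edge i h)" using F h6 by (rule join_facet.intros)
      interpret generic_simplex W "2 * m - 1" "2 * i" "F \<union> hex_edge i h"
        using gen[OF _ F'] join_facet_finite[OF F'] join_facet_card[OF F'] assms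
        by unfold_locales auto
      show ?thesis
        unfolding has_zero_parity sum_facets_join[OF F h6, of ?P] hmod ..
    qed
    then have "join_sum i (\<lambda>F. of_bool (has_zero W (Suc (2 * i)) (F \<union> hex_edge i h))) =
      join_sum i (\<lambda>F. (\<Sum>v\<in>F. ?P (F - {v} \<union> hex_edge i h)) + ?P (insert (i, h) F) + ?P (insert (i, h + 1) F))"
      by (rule join_sum_cong)
    also have "\<dots> = g h + g (h + 1)"
      by (simp add: join_sum_add join_sum_boundary[of i "\<lambda>F. ?P (F \<union> hex_edge i h)"] g_def)
    finally show ?thesis .
  qed
  have "odd_count i = (\<Sum>h<3. g h + g (h + 1))"
    unfolding odd_count_def by (intro sum.cong refl summand) simp
  also have "\<dots> = g 0 + g 3"
    using sum_lessThan_telescope[of g 3] by (simp add: add.commute)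
  also have "g 3 = join_sum i (\<lambda>F. ?P (antipode ` insert (i, 0) F))"
    using join_sum_antipode[of i "\<lambda>F. ?P (insert (i, 3) F)"] by (simp add: g_def antipode_def)
  also have "g 0 + \<dots> = join_sum i (\<lambda>F. ?P (insert (i, 0) F) + ?P (antipode ` insert (i, 0) F))"
    by (simp add: g_def join_sum_add)
  also have "\<dots> = even_count i"
    unfolding even_count_def
  proof (rule join_sum_cong)
    fix F assume F: "join_facet i F"
    then have "join_facet (Suc i) (F \<union> hex_edge i 0)" by (rule join_facet.intros) simp
    then have G: "generic W (2 * m - 1) (insert (i, 0) F)"
      by (rule generic_subset[OF gen[rotated]]) (use assms in \<open>auto simp: hex_edge_def\<close>)
    have sub: "(i, 0) \<notin> F" "\<And>v. v \<in> F \<Longrightarrow> snd v < 6" using join_facet_sub[OF F] by auto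
    show "?P (insert (i, 0) F) + ?P (antipode ` insert (i, 0) F)
        = of_bool (has_zero W (2 * i) (insert (i, 0) F))"
      by (rule has_zero_antipodal[OF G, symmetric])
        (use sub assms join_facet_finite[OF F] join_facet_card[OF F] in
          \<open>auto simp: antipode_antipode antipodal\<close>)
  qed
  finally show ?thesis .
qed

text \<open>
  The base of the cone is the whole join of hexagons, and its facets come in antipodal pairs: the edges
  \<open>h\<close> and \<open>h + 3\<close> of the last hexagon.
\<close>

lemma even_count_Suc:
  assumes "Suc i < m"
  shows "even_count (Suc i) = odd_count i"
proof -
  let ?k = "Suc (2 * i)"
  let ?P = "\<lambda>T. of_bool (has_pos_zero W ?k T) :: bit"
  have "of_bool (has_zero W (2 * Suc i) (insert (Suc i, 0) F)) =
      ?P F + (\<Sum>v\<in>F. ?P (insert (Suc i, 0) (F - {v})))"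
    if F: "join_facet (Suc i) F" for F
  proof -
    have "join_facet (Suc (Suc i)) (F \<union> hex_edge (Suc i) 0)" using F by (rule join_facet.intros) simp
    then have G: "generic W (2 * m - 1) (insert (Suc i, 0) F)"
      by (rule generic_subset[OF gen[rotated]]) (use assms in \<open>auto simp: hex_edge_def\<close>)
    have new: "(Suc i, 0) \<notin> F" using join_facet_sub[OF F] by auto
    note fin = join_facet_finite[OF F]
    interpret generic_simplex W "2 * m - 1" ?k "insert (Suc i, 0) F"
      using G new fin join_facet_card[OF F] assms by unfold_locales auto
    have "of_bool (has_zero W (Suc ?k) (insert (Suc i, 0) F)) =
        ?P (insert (Suc i, 0) F - {(Suc i, 0)}) + (\<Sum>v\<in>F. ?P (insert (Suc i, 0) F - {v}))"
      unfolding has_zero_parity using new fin by simp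
    also have "insert (Suc i, 0) F - {(Suc i, 0)} = F" using new by auto
    also have "(\<Sum>v\<in>F. ?P (insert (Suc i, 0) F - {v})) = (\<Sum>v\<in>F. ?P (insert (Suc i, 0) (F - {v})))"
      using new by (intro sum.cong refl arg_cong[where f = ?P]) auto
    finally show ?thesis by simp
  qed
  then have "even_count (Suc i) =
      join_sum (Suc i) (\<lambda>F. ?P F + (\<Sum>v\<in>F. ?P (insert (Suc i, 0) (F - {v}))))"
    unfolding even_count_def by (rule join_sum_cong)
  also have "\<dots> = join_sum (Suc i) ?P"
    unfolding join_sum_add using join_sum_boundary[of "Suc i" "\<lambda>F. ?P (insert (Suc i, 0) F)"] by simp
  also have "\<dots> = (\<Sum>h<3. join_sum i (\<lambda>F. ?P (F \<union> hex_edge i h)) + join_sum i (\<lambda>F. ?P (F \<union> hex_edge i (h + 3))))"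
    by (simp add: sum_less_6 sum_less_3 add_ac)
  also have "\<dots> = odd_count i"
    unfolding odd_count_def
  proof (rule sum.cong)
    fix h :: nat assume "h \<in> {..<3}"
    then have h: "h < 6" "(h + 3) mod 6 = h + 3" by auto
    have "join_sum i (\<lambda>F. ?P (F \<union> hex_edge i (h + 3))) = join_sum i (\<lambda>F. ?P (antipode ` (F \<union> hex_edge i h)))"
      using join_sum_antipode[of i "\<lambda>F. ?P (F \<union> hex_edge i (h + 3))"]
      by (simp add: image_Un antipode_hex_edge h)
    then have "join_sum i (\<lambda>F. ?P (F \<union> hex_edge i h)) + join_sum i (\<lambda>F. ?P (F \<union> hex_edge i (h + 3))) =
        join_sum i (\<lambda>F. ?P (F \<union> hex_edge i h) + ?P (antipode ` (F \<union> hex_edge i h)))"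
      by (simp add: join_sum_add)
    also have "\<dots> = join_sum i (\<lambda>F. of_bool (has_zero W ?k (F \<union> hex_edge i h)))"
    proof (rule join_sum_cong)
      fix F assume "join_facet i F"
      then have F: "join_facet (Suc i) (F \<union> hex_edge i h)" using h(1) by (rule join_facet.intros)
      show "?P (F \<union> hex_edge i h) + ?P (antipode ` (F \<union> hex_edge i h))
          = of_bool (has_zero W ?k (F \<union> hex_edge i h))"
      proof (rule has_zero_antipodal[symmetric])
        show "generic W (2 * m - 1) (F \<union> hex_edge i h)" using gen[OF _ F] assms by simp
        show "finite (F \<union> hex_edge i h)" by (rule join_facet_finite[OF F])
        show "card (F \<union> hex_edge i h) = Suc ?k" using join_facet_card[OF F] by simp
        show "Suc ?k \<le> 2 * m - 1" using assms by simp
        fix v assume "v \<in> F \<union> hex_edge i h"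
        then have "snd v < 6" using join_facet_sub[OF F] by auto
        then show "antipode (antipode v) = v" "\<And>j. W j (antipode v) = - W j v"
          by (auto simp: antipode_antipode antipodal)
      qed
    qed
    finally show "join_sum i (\<lambda>F. ?P (F \<union> hex_edge i h)) + join_sum i (\<lambda>F. ?P (F \<union> hex_edge i (h + 3))) =
      join_sum i (\<lambda>F. of_bool (has_zero W ?k (F \<union> hex_edge i h)))" .
  qed simp
  finally show ?thesis .
qed

lemma counts_one: "i < m \<Longrightarrow> even_count i = 1 \<and> odd_count i = 1"
proof (induction i)
  case 0
  have "even_count 0 = 1"
    by (auto simp: even_count_def has_zero_def dependence_def intro: exI[of _ "\<lambda>_. 1"])
  with odd_count_eq[OF 0] show ?case by simp
next
  case (Suc i)
  then show ?case using even_count_Suc odd_count_eq by simp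
qed

lemma exists_zero_facet:
  assumes "m > 0"
  shows "\<exists>F. join_facet m F \<and> has_zero W (2 * m - 1) F"
proof (rule ccontr)
  assume none: "\<not> ?thesis"
  define i where "i = m - 1"
  have i: "Suc i = m" "i < m" "Suc (2 * i) = 2 * m - 1" using assms by (auto simp: i_def)
  have "join_sum i (\<lambda>F. of_bool (has_zero W (Suc (2 * i)) (F \<union> hex_edge i h))) = join_sum i (\<lambda>F. 0)"
    if "h < 3" for h
  proof (rule join_sum_cong)
    fix F assume "join_facet i F"
    then have "join_facet m (F \<union> hex_edge i h)"
      using join_facet.intros(2)[of i F h] that i by simp
    with none i show "of_bool (has_zero W (Suc (2 * i)) (F \<union> hex_edge i h)) = (0 :: bit)" by auto
  qed
  then have "odd_count i = 0" by (simp add: odd_count_def join_sum_zero)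
  with counts_one[OF i(2)] show False by simp
qed

end

section \<open>From generic to arbitrary functionals\<close>

text \<open>
  Treat the hyperplanes one after the other: moving \<open>b\<close> along the normal \<open>x\<close> of the new one leaves it, and
  meets each of the other hyperplanes at most once.
\<close>

lemma avoid_hyperplanes:
  fixes a :: "'u \<Rightarrow> real"
  assumes X: "finite X" and C: "finite C" "\<forall>x\<in>C. \<exists>u\<in>X. x u \<noteq> 0" and e: "e > 0"
  shows "\<exists>b. (\<forall>u\<in>X. \<bar>b u - a u\<bar> < e) \<and> (\<forall>x\<in>C. (\<Sum>u\<in>X. x u * b u) \<noteq> 0)"
  using C e
proof (induction C arbitrary: e rule: finite_induct)
  case empty
  then show ?case by (intro exI[of _ a]) simp
next
  case (insert x C)
  obtain b where b: "\<forall>u\<in>X. \<bar>b u - a u\<bar> < e / 2" "\<forall>y\<in>C. (\<Sum>u\<in>X. y u * b u) \<noteq> 0"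
    using insert.IH[of "e / 2"] insert.prems by auto
  define M where "M = (\<Sum>u\<in>X. \<bar>x u\<bar>)"
  have M: "\<bar>x u\<bar> \<le> M" if "u \<in> X" for u
    unfolding M_def using X that by (intro member_le_sum) auto
  have M0: "M \<ge> 0" unfolding M_def by (simp add: sum_nonneg)
  \<comment> \<open>The parameters \<open>t\<close> at which \<open>b + t * x\<close> lies on one of the hyperplanes.\<close>
  define B where "B = (\<Union>y\<in>insert x C. {t. (\<Sum>u\<in>X. y u * b u) + t * (\<Sum>u\<in>X. y u * x u) = 0})"
  have line: "finite {t :: real. c + t * d = 0}" if "c \<noteq> 0 \<or> d \<noteq> 0" for c d :: real
  proof -
    have "{t. c + t * d = 0} \<subseteq> {- c / d}" using that by (cases "d = 0") (auto simp: field_simps add_eq_0_iff)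
    then show ?thesis by (rule finite_subset) simp
  qed
  have "(\<Sum>u\<in>X. x u * x u) \<noteq> 0"
    using insert.prems(1) X by (subst sum_nonneg_eq_0_iff) auto
  then have "finite B"
    unfolding B_def using insert.hyps(1) b(2) by (intro finite_UN_I line) auto
  moreover have "infinite {0<..<e / (2 * (M + 1))}"
    using insert.prems(2) M0 by (intro infinite_Ioo) simp
  ultimately obtain t where t: "t \<in> {0<..<e / (2 * (M + 1))}" "t \<notin> B"
    by (metis finite_subset subsetI)
  have "\<bar>(b u + t * x u) - a u\<bar> < e" if u: "u \<in> X" for u
  proof -
    have "\<bar>t * x u\<bar> \<le> t * (M + 1)"
      using t M[OF u] by (simp add: abs_mult mult_left_mono)
    also have "\<dots> < e / 2" using t M0 by (simp add: field_simps)
    finally have "\<bar>t * x u\<bar> < e / 2" .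
    moreover have "\<bar>b u - a u\<bar> < e / 2" using b(1) u by blast
    ultimately show ?thesis by linarith
  qed
  moreover have "(\<Sum>u\<in>X. y u * (b u + t * x u)) \<noteq> 0" if "y \<in> insert x C" for y
  proof -
    have "(\<Sum>u\<in>X. y u * (b u + t * x u)) = (\<Sum>u\<in>X. y u * b u) + t * (\<Sum>u\<in>X. y u * x u)"
      by (simp add: sum_distrib_left sum.distrib algebra_simps)
    with t(2) that show ?thesis unfolding B_def by auto
  qed
  ultimately show ?case by (intro exI[of _ "\<lambda>u. b u + t * x u"]) blast
qed

text \<open>
  Perturb one functional at a time. Given generic \<open>n\<close> functionals, the dependences on each set of
  \<open>n + 1\<close> vectors are the multiples of a single one, and the next functional only has to be nonzero on
  each of these finitely many dependences.
\<close>

lemma generic_perturbation: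
  assumes X: "finite X" and e: "e > 0"
  shows "\<exists>L'. generic L' n X \<and> (\<forall>j. \<forall>u\<in>X. \<bar>L' j u - L j u\<bar> < e)"
proof (induction n)
  case 0
  have "generic L 0 X"
    unfolding generic_def using finite_subset[OF _ X] by auto
  with e show ?case by (intro exI[of _ L]) simp
next
  case (Suc n)
  then obtain L' where L': "generic L' n X" "\<forall>j. \<forall>u\<in>X. \<bar>L' j u - L j u\<bar> < e" by blast
  have "\<exists>x. dependence L' n U x \<and> (\<exists>v\<in>U. x v \<noteq> 0) \<and> (\<forall>v. v \<notin> U \<longrightarrow> x v = 0)"
    if U: "U \<subseteq> X" "card U = Suc n" for U
  proof -
    obtain x where x: "dependence L' n U x" "\<exists>v\<in>U. x v \<noteq> 0"
      using dependence_exists[of U n L'] finite_subset[OF U(1) X] U(2) by auto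
    then show ?thesis
      by (intro exI[of _ "\<lambda>v. if v \<in> U then x v else 0"]) (simp add: dependence_def cong: sum.cong)
  qed
  then obtain k where k: "\<And>U. U \<subseteq> X \<Longrightarrow> card U = Suc n \<Longrightarrow>
      dependence L' n U (k U) \<and> (\<exists>v\<in>U. k U v \<noteq> 0) \<and> (\<forall>v. v \<notin> U \<longrightarrow> k U v = 0)"
    by metis
  define C where "C = k ` {U. U \<subseteq> X \<and> card U = Suc n}"
  have "finite C" using X by (simp add: C_def)
  moreover have "\<forall>x\<in>C. \<exists>u\<in>X. x u \<noteq> 0" using k unfolding C_def by blast
  ultimately obtain b where b: "\<forall>u\<in>X. \<bar>b u - L n u\<bar> < e" "\<forall>x\<in>C. (\<Sum>u\<in>X. x u * b u) \<noteq> 0"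
    using avoid_hyperplanes[OF X _ _ e, of C "L n"] by blast
  define L'' where "L'' = L'(n := b)"
  have same: "dependence L'' j U x \<longleftrightarrow> dependence L' j U x" if "j \<le> n" for j U x
    using that by (auto simp: dependence_def L''_def)
  have "generic L'' (Suc n) X"
    unfolding generic_def
  proof (intro allI impI ballI)
    fix U x v assume U: "U \<subseteq> X" "card U \<le> Suc n" "dependence L'' (card U) U x" and v: "v \<in> U"
    have finU: "finite U" using U X finite_subset by blast
    show "x v = 0"
    proof (cases "card U \<le> n")
      case True
      then show ?thesis using U L'(1) v same unfolding generic_def by blast
    next
      case False
      then have c: "card U = Suc n" using U by simp
      note kU = k[OF U(1) c]
      then obtain w where w: "w \<in> U" "k U w \<noteq> 0" by blast
      have dx: "dependence L' n U x" using U(3) c same[of n U x] by (simp add: dependence_def)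
      define r where "r = x w / k U w"
      have multiple: "x u = r * k U u" if u: "u \<in> U" for u
      proof -
        define z where "z u = 1 * x u + (- r) * k U u" for u
        have dz: "dependence L' n U z"
          unfolding z_def using dx kU by (intro dependence_combination) auto
        have "z u = 0"
        proof (rule generic_vanish[OF generic_subset[OF L'(1) U(1)] finU _ _ order_refl dz _ u])
          show "card (U - {w}) \<le> n" using c w finU by simp
          show "z v = 0" if "v \<in> U - (U - {w})" for v using that w by (auto simp: z_def r_def)
        qed auto
        then show ?thesis by (simp add: z_def)
      qed
      have "(\<Sum>u\<in>X. k U u * b u) = (\<Sum>u\<in>U. k U u * b u)"
        using X U(1) kU by (intro sum.mono_neutral_right) auto
      then have kb: "(\<Sum>u\<in>U. k U u * b u) \<noteq> 0" using b(2) U(1) c unfolding C_def by auto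
      have "(\<Sum>u\<in>U. x u * b u) = 0" using U(3) c by (auto simp: dependence_def L''_def)
      moreover have "(\<Sum>u\<in>U. x u * b u) = r * (\<Sum>u\<in>U. k U u * b u)"
        by (simp add: multiple sum_distrib_left mult.assoc)
      ultimately have "r = 0" using kb by simp
      with multiple v show ?thesis by simp
    qed
  qed
  moreover have "\<forall>j. \<forall>u\<in>X. \<bar>L'' j u - L j u\<bar> < e"
    using L'(2) b(1) by (simp add: L''_def)
  ultimately show ?case by blast
qed

definition index :: "nat \<times> nat \<Rightarrow> nat \<times> nat" where
  "index v = (fst v, snd v mod 3)"

definition signed :: "(nat \<Rightarrow> nat \<times> nat \<Rightarrow> real) \<Rightarrow> nat \<Rightarrow> nat \<times> nat \<Rightarrow> real" where
  "signed L j v = (- 1) ^ snd v * L j (index v)"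

text \<open>
  Turns coefficients of the signed vectors into coefficients of the unit vectors.
\<close>

definition unsign :: "(nat \<times> nat) set \<Rightarrow> (nat \<times> nat \<Rightarrow> real) \<Rightarrow> nat \<times> nat \<Rightarrow> real" where
  "unsign F x w = (\<Sum>v | v \<in> F \<and> index v = w. (- 1) ^ snd v * x v)"

lemma balanced_inj_index: "balanced F \<Longrightarrow> inj_on index F"
  unfolding inj_on_def balanced_def index_def by (metis Pair_inject)

lemma unsign_index: 
  assumes "inj_on index F" "v \<in> F"
  shows "unsign F x (index v) = (- 1) ^ snd v * x v"
proof -
  have "{u. u \<in> F \<and> index u = index v} = {v}" using assms by (auto dest: inj_onD)
  then show ?thesis by (simp add: unsign_def)
qed

lemma unsign_outside: "w \<notin> index ` F \<Longrightarrow> unsign F x w = 0"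
  unfolding unsign_def by (rule sum.neutral) auto

lemma dependence_unsign:
  assumes "inj_on index F"
  shows "dependence L k (index ` F) (unsign F x) \<longleftrightarrow> dependence (signed L) k F x"
proof -
  have "(\<Sum>w\<in>index ` F. unsign F x w * L j w) = (\<Sum>v\<in>F. x v * signed L j v)" for j
    using assms by (simp add: sum.reindex unsign_index signed_def mult_ac cong: sum.cong_simp)
  then show ?thesis by (simp add: dependence_def)
qed

lemma generic_signed:
  assumes L: "generic L n X" and F: "balanced F" "index ` F \<subseteq> X"
  shows "generic (signed L) n F"
  unfolding generic_def
proof (intro allI impI ballI)
  fix U x v assume U: "U \<subseteq> F" "card U \<le> n" "dependence (signed L) (card U) U x" and v: "v \<in> U"
  have inj: "inj_on index U" using balanced_inj_index[OF F(1)] U(1) inj_on_subset by blast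
  have "dependence L (card (index ` U)) (index ` U) (unsign U x)"
    using U(3) by (simp add: dependence_unsign[OF inj] card_image[OF inj])
  moreover have "index ` U \<subseteq> X" "card (index ` U) \<le> n"
    using U F(2) by (auto simp: card_image[OF inj])
  ultimately have "unsign U x (index v) = 0"
    using L v unfolding generic_def by blast
  with unsign_index[OF inj v] show "x v = 0" by simp
qed

lemma antipodal_map_signed:
  assumes "generic L (2 * m - 1) ({..<m} \<times> {..<3})"
  shows "antipodal_map (signed L) m"
proof
  fix j :: nat and v :: "nat \<times> nat" assume v: "snd v < 6"
  have "(- 1 :: real) ^ ((snd v + 3) mod 6) = - ((- 1) ^ snd v)"
    using less_6_cases[OF v] by auto
  moreover have "index (antipode v) = index v"
    using less_6_cases[OF v] by (auto simp: index_def antipode_def)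
  ultimately show "signed L j (antipode v) = - signed L j v"
    by (simp add: signed_def) (simp add: antipode_def)
next
  fix i F assume F: "i \<le> m" "join_facet i F"
  have "index ` F \<subseteq> {..<m} \<times> {..<3}"
    using join_facet_sub[OF F(2)] F(1) by (force simp: index_def)
  with assms join_facet_balanced[OF F(2)] show "generic (signed L) (2 * m - 1) F"
    by (rule generic_signed)
qed

definition crossing_pattern :: "nat \<Rightarrow> (nat \<times> nat \<Rightarrow> real) \<Rightarrow> bool" where
  "crossing_pattern m y \<longleftrightarrow> (\<forall>i<m. \<forall>a<3. \<forall>b<3. a \<noteq> b \<longrightarrow>
     \<not> (y (i, a) > 0 \<and> y (i, b) > 0) \<and> \<not> (y (i, a) < 0 \<and> y (i, b) < 0))"

text \<open>
  The normalization keeps the dependences away from zero in the passage to the limit.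
\<close>

lemma crossing_dependence_generic:
  assumes gen: "generic L (2 * m - 1) ({..<m} \<times> {..<3})" and m: "m > 0"
  shows "\<exists>y. (\<Sum>v\<in>{..<m} \<times> {..<3}. \<bar>y v\<bar>) = 1 \<and> dependence L (2 * m - 1) ({..<m} \<times> {..<3}) y \<and>
    crossing_pattern m y"
proof -
  let ?X = "{..<m} \<times> {..<3::nat}"
  obtain F x where F: "join_facet m F" and x: "\<forall>v\<in>F. x v > 0" "dependence (signed L) (2 * m - 1) F x"
    using antipodal_map.exists_zero_facet[OF antipodal_map_signed[OF gen] m]
    unfolding has_zero_def by blast
  have bal: "balanced F" by (rule join_facet_balanced[OF F])
  note inj = balanced_inj_index[OF bal]
  have sub: "index ` F \<subseteq> ?X" using join_facet_sub[OF F] by (force simp: index_def)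
  define y where "y = unsign F x"
  have "dependence L (2 * m - 1) (index ` F) y"
    using x(2) by (simp add: y_def dependence_unsign[OF inj])
  then have dy: "dependence L (2 * m - 1) ?X y"
    by (rule dependence_extend) (use sub in \<open>auto simp: y_def unsign_outside\<close>)
  have sign: "\<exists>v\<in>F. w = index v \<and> (if even (snd v) then y w > 0 else y w < 0)" if "y w \<noteq> 0" for w
  proof -
    have "w \<in> index ` F" using that unsign_outside[of w F x] by (auto simp only: y_def)
    then obtain v where v: "v \<in> F" "w = index v" by blast
    have "x v > 0" "y w = (- 1) ^ snd v * x v"
      using v x(1) by (simp_all add: y_def unsign_index[OF inj])
    with v show ?thesis by (intro bexI[of _ v]) simp_all
  qed
  have pat: "crossing_pattern m y"
    unfolding crossing_pattern_def
  proof (intro allI impI)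
    fix i a b :: nat assume ab: "a \<noteq> b"
    have "\<not> (even (snd u) \<longleftrightarrow> even (snd v))" if "u \<in> F" "v \<in> F" "(i, a) = index u" "(i, b) = index v" for u v
      using that ab bal unfolding balanced_def index_def by (metis Pair_inject)
    note parity = this
    have "(y (i, a) > 0) \<noteq> (y (i, b) > 0)" if nz: "y (i, a) \<noteq> 0" "y (i, b) \<noteq> 0"
    proof -
      from sign[OF nz(1)] obtain u where u: "u \<in> F" "(i, a) = index u"
        "if even (snd u) then y (i, a) > 0 else y (i, a) < 0" by blast
      from sign[OF nz(2)] obtain v where v: "v \<in> F" "(i, b) = index v"
        "if even (snd v) then y (i, b) > 0 else y (i, b) < 0" by blast
      from parity[OF u(1) v(1) u(2) v(2)] u(3) v(3) show ?thesis by (auto split: if_splits)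
    qed
    then show "\<not> (y (i, a) > 0 \<and> y (i, b) > 0) \<and> \<not> (y (i, a) < 0 \<and> y (i, b) < 0)"
      by force
  qed
  define N where "N = (\<Sum>v\<in>?X. \<bar>y v\<bar>)"
  have "F \<noteq> {}" using join_facet_card[OF F] m by auto
  then obtain v where v: "v \<in> F" by blast
  then have "y (index v) \<noteq> 0" using x(1) by (auto simp: y_def unsign_index[OF inj])
  moreover have "index v \<in> ?X" using v sub by blast
  ultimately have N: "N > 0"
    unfolding N_def by (intro sum_pos2[of _ "index v"]) auto
  define z where "z w = (1 / N) * y w + 0 * y w" for w
  have "dependence L (2 * m - 1) ?X z"
    unfolding z_def by (rule dependence_combination[OF dy dy])
  moreover have "crossing_pattern m z"
    using pat N by (simp add: crossing_pattern_def z_def zero_less_divide_iff divide_less_0_iff)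
  moreover have "(\<Sum>v\<in>?X. \<bar>z v\<bar>) = 1"
  proof -
    have "(\<Sum>v\<in>?X. \<bar>z v\<bar>) = (\<Sum>v\<in>?X. \<bar>y v\<bar>) / N"
      using N by (simp add: z_def abs_mult sum_divide_distrib)
    with N show ?thesis by (simp add: N_def[symmetric])
  qed
  ultimately show ?thesis by blast
qed

lemma convergent_subsequence_finite:
  fixes y :: "nat \<Rightarrow> 'u \<Rightarrow> real"
  assumes "finite X" "\<And>t u. u \<in> X \<Longrightarrow> \<bar>y t u\<bar> \<le> 1"
  shows "\<exists>r l. strict_mono r \<and> (\<forall>u\<in>X. (\<lambda>t. y (r t) u) \<longlonglongrightarrow> l u)"
  using assms
proof (induction X rule: finite_induct)
  case empty
  then show ?case by (auto intro!: exI[of _ id] strict_mono_id)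
next
  case (insert a X)
  then obtain r l where r: "strict_mono r" "\<forall>u\<in>X. (\<lambda>t. y (r t) u) \<longlonglongrightarrow> l u" by auto
  have "bounded (range (\<lambda>t. y (r t) a))"
    using insert.prems by (intro boundedI[of _ 1]) auto
  then obtain c s where s: "strict_mono s" "(\<lambda>t. y (r (s t)) a) \<longlonglongrightarrow> c"
    using bounded_imp_convergent_subsequence[of "\<lambda>t. y (r t) a"] by (auto simp: o_def)
  have "(\<lambda>t. y ((r \<circ> s) t) u) \<longlonglongrightarrow> (l(a := c)) u" if "u \<in> insert a X" for u
  proof (cases "u = a")
    case False
    with r(2) that have "(\<lambda>t. y (r t) u) \<longlonglongrightarrow> l u" by blast
    from LIMSEQ_subseq_LIMSEQ[OF this s(1)] False show ?thesis by (simp add: o_def)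
  qed (use s(2) in simp)
  moreover have "strict_mono (r \<circ> s)" using r(1) s(1) by (rule strict_mono_o)
  ultimately show ?case by blast
qed

text \<open>
  Linear van Kampen--Flores theorem. The condition on the signs is closed, so a limit of dependences of
  generic functionals has it as well.
\<close>

theorem crossing_dependence:
  assumes m: "m > 0" and n: "n \<le> 2 * m - 1"
  shows "\<exists>y. (\<exists>v\<in>{..<m} \<times> {..<3}. y v \<noteq> 0) \<and> dependence L n ({..<m} \<times> {..<3}) y \<and> crossing_pattern m y"
proof -
  let ?X = "{..<m} \<times> {..<3::nat}"
  have "\<exists>L' y. (\<forall>j. \<forall>u\<in>?X. \<bar>L' j u - L j u\<bar> < 1 / real (Suc t)) \<and> (\<Sum>v\<in>?X. \<bar>y v\<bar>) = 1 \<and>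
    dependence L' (2 * m - 1) ?X y \<and> crossing_pattern m y" for t
  proof -
    obtain L' where L': "generic L' (2 * m - 1) ?X" "\<forall>j. \<forall>u\<in>?X. \<bar>L' j u - L j u\<bar> < 1 / real (Suc t)"
      using generic_perturbation[of ?X "1 / real (Suc t)" "2 * m - 1" L] by auto
    with crossing_dependence_generic[OF L'(1) m] show ?thesis by blast
  qed
  then obtain L' y where L': "\<And>t j u. u \<in> ?X \<Longrightarrow> \<bar>L' t j u - L j u\<bar> < 1 / real (Suc t)"
    and y: "\<And>t. (\<Sum>v\<in>?X. \<bar>y t v\<bar>) = 1" "\<And>t. dependence (L' t) (2 * m - 1) ?X (y t)"
      "\<And>t. crossing_pattern m (y t)"
    by metis
  have bound: "\<bar>y t u\<bar> \<le> 1" if "u \<in> ?X" for t u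
    unfolding y(1)[of t, symmetric] using that by (intro member_le_sum) auto
  have finX: "finite ?X" by simp
  from convergent_subsequence_finite[of ?X y, OF finX bound]
  obtain r l where r: "strict_mono r" and l: "\<And>u. u \<in> ?X \<Longrightarrow> (\<lambda>t. y (r t) u) \<longlonglongrightarrow> l u"
    by blast
  have Llim: "(\<lambda>t. L' (r t) j u) \<longlonglongrightarrow> L j u" if "u \<in> ?X" for j u
  proof -
    have "(\<lambda>t. L' t j u - L j u) \<longlonglongrightarrow> 0"
    proof (rule Lim_null_comparison)
      show "(\<lambda>t. 1 / real (Suc t)) \<longlonglongrightarrow> 0" by (rule LIMSEQ_Suc[OF lim_1_over_n])
      show "\<forall>\<^sub>F t in sequentially. norm (L' t j u - L j u) \<le> 1 / real (Suc t)"
        using L'[OF that] by (auto simp: less_imp_le simp del: of_nat_Suc)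
    qed
    then have "(\<lambda>t. L' t j u) \<longlonglongrightarrow> L j u" by (simp add: LIM_zero_iff)
    from LIMSEQ_subseq_LIMSEQ[OF this r] show ?thesis by (simp add: o_def)
  qed
  have "dependence L n ?X l"
    unfolding dependence_def
  proof (intro allI impI)
    fix j assume "j < n"
    then have "(\<Sum>u\<in>?X. y (r t) u * L' (r t) j u) = 0" for t
      using y(2)[of "r t"] n by (simp add: dependence_def)
    moreover have "(\<lambda>t. \<Sum>u\<in>?X. y (r t) u * L' (r t) j u) \<longlonglongrightarrow> (\<Sum>u\<in>?X. l u * L j u)"
      by (intro tendsto_sum tendsto_mult l Llim)
    ultimately show "(\<Sum>u\<in>?X. l u * L j u) = 0" by (simp add: LIMSEQ_const_iff)
  qed
  moreover have "\<exists>v\<in>?X. l v \<noteq> 0"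
  proof (rule ccontr)
    assume "\<not> ?thesis"
    then have "(\<Sum>u\<in>?X. \<bar>l u\<bar>) = 0" by (intro sum.neutral) auto
    moreover have "(\<lambda>t. \<Sum>u\<in>?X. \<bar>y (r t) u\<bar>) \<longlonglongrightarrow> (\<Sum>u\<in>?X. \<bar>l u\<bar>)"
      by (intro tendsto_sum tendsto_rabs l)
    ultimately show False by (simp add: y(1) LIMSEQ_const_iff)
  qed
  moreover have "crossing_pattern m l"
    unfolding crossing_pattern_def
  proof (intro allI impI conjI notI)
    fix i a b :: nat assume iab: "i < m" "a < 3" "b < 3" "a \<noteq> b"
    then have lim: "(\<lambda>t. y (r t) (i, a)) \<longlonglongrightarrow> l (i, a)" "(\<lambda>t. y (r t) (i, b)) \<longlonglongrightarrow> l (i, b)"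
      by (auto intro: l)
    have pat: "\<not> (y t (i, a) > 0 \<and> y t (i, b) > 0)" "\<not> (y t (i, a) < 0 \<and> y t (i, b) < 0)" for t
      using y(3)[of t] iab by (auto simp: crossing_pattern_def)
    {
      assume "l (i, a) > 0 \<and> l (i, b) > 0"
      then have "\<forall>\<^sub>F t in sequentially. y (r t) (i, a) > 0 \<and> y (r t) (i, b) > 0"
        using lim by (intro eventually_conj order_tendstoD) auto
      then show False using pat(1) eventually_happens'[OF sequentially_bot] by blast
    next
      assume "l (i, a) < 0 \<and> l (i, b) < 0"
      then have "\<forall>\<^sub>F t in sequentially. y (r t) (i, a) < 0 \<and> y (r t) (i, b) < 0"
        using lim by (intro eventually_conj order_tendstoD) auto
      then show False using pat(2) eventually_happens'[OF sequentially_bot] by blast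
    }
  qed
  ultimately show ?thesis by blast
qed

section \<open>Crossings in general position\<close>

lemma lookup_scaleR: "Poly_Mapping.lookup (r *\<^sub>R x) i = r * Poly_Mapping.lookup x i"
  for x :: "'i \<Rightarrow>\<^sub>0 real"
proof -
  have "finite {i. r *\<^sub>R Poly_Mapping.lookup x i \<noteq> 0}"
    by (rule finite_subset[of _ "Poly_Mapping.keys x"]) (auto simp: in_keys_iff)
  then show ?thesis by (simp add: scaleR_poly_mapping_def)
qed

lemma abs_lookup_le_norm: "\<bar>Poly_Mapping.lookup x i\<bar> \<le> norm x"
  for x :: "'i \<Rightarrow>\<^sub>0 real"
proof (cases "i \<in> Poly_Mapping.keys x")
  case True
  then have "\<bar>Poly_Mapping.lookup x i\<bar> \<le> (\<Sum>j\<in>Poly_Mapping.keys x. \<bar>Poly_Mapping.lookup x j\<bar>)"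
    by (intro member_le_sum) auto
  then show ?thesis by (simp add: norm_poly_mapping_def dist_poly_mapping_def)
next
  case False
  then show ?thesis by (simp add: in_keys_iff)
qed

lemma continuous_lookup: "continuous_on S (\<lambda>x. Poly_Mapping.lookup x i)"
  for S :: "('i \<Rightarrow>\<^sub>0 real) set"
proof (rule linear_continuous_on)
  show "bounded_linear (\<lambda>x :: 'i \<Rightarrow>\<^sub>0 real. Poly_Mapping.lookup x i)"
    using abs_lookup_le_norm
    by (intro bounded_linear_intro[where K = 1]) (auto simp: lookup_add lookup_scaleR)
qed

lemma annihilating_functional_exists:
  fixes A :: "nat \<Rightarrow> 'v \<Rightarrow> real"
  assumes "finite P" "finite I" "card P < card I"
  shows "\<exists>c. (\<exists>i\<in>I. c i \<noteq> 0) \<and> (\<forall>v\<in>P. (\<Sum>i\<in>I. c i * A i v) = 0)"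
proof -
  obtain f where f: "bij_betw f {..<card P} P"
    using ex_bij_betw_nat_finite[OF assms(1)] by (auto simp: atLeast0LessThan)
  obtain c where c: "dependence (\<lambda>j i. A i (f j)) (card P) I c" "\<exists>i\<in>I. c i \<noteq> 0"
    using dependence_exists[OF assms(2,3)] by blast
  have "(\<Sum>i\<in>I. c i * A i v) = 0" if v: "v \<in> P" for v
  proof -
    obtain j where "j < card P" "v = f j" using f v by (auto simp: bij_betw_def)
    with c(1) show ?thesis by (simp add: dependence_def)
  qed
  with c(2) show ?thesis by blast
qed

text \<open>
  Any \<open>d + 1\<close> of the points are affinely independent. Having at least \<open>d + 1\<close> vertices allows every
  smaller set to be completed to one that is covered by this condition.
\<close>

locale general_position =
  fixes d :: nat and p :: "'v \<Rightarrow> (nat \<Rightarrow>\<^sub>0 real)" and V :: "'v set"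
  assumes finite_V: "finite V" and d_pos: "d > 0" and card_V: "Suc d \<le> card V"
    and in_space: "p ` V \<subseteq> real_space d" and inj_p: "inj_on p V"
    and no_hyperplane: "\<And>S h. S \<subseteq> V \<Longrightarrow> card S = Suc d \<Longrightarrow> is_hyperplane d h \<Longrightarrow> \<not> p ` S \<subseteq> h"
begin

text \<open>
  Homogeneous coordinates: the last entry \<open>1\<close> turns affine dependences into linear ones.
\<close>

definition coord :: "nat \<Rightarrow> 'v \<Rightarrow> real" where
  "coord i v = (if i < d then Poly_Mapping.lookup (p v) i else 1)"

lemma functional_split: "(\<Sum>i\<le>d. c i * coord i v) = (\<Sum>i<d. c i * Poly_Mapping.lookup (p v) i) + c d"
  by (simp add: lessThan_Suc_atMost[symmetric] coord_def)

lemma functional_vanish: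
  assumes S: "S \<subseteq> V" "card S = Suc d" and c: "\<And>v. v \<in> S \<Longrightarrow> (\<Sum>i\<le>d. c i * coord i v) = 0"
    and i: "i \<le> d"
  shows "c i = 0"
proof (rule ccontr)
  assume ci: "c i \<noteq> 0"
  from S obtain v where v: "v \<in> S" by fastforce
  define h where "h = {x \<in> real_space d. (\<Sum>i<d. c i * Poly_Mapping.lookup x i) = - c d}"
  have "\<exists>i<d. c i \<noteq> 0"
  proof (rule ccontr)
    assume none: "\<not> ?thesis"
    with ci i have "c d \<noteq> 0" by (metis le_neq_implies_less)
    moreover have "(\<Sum>i<d. c i * Poly_Mapping.lookup (p v) i) = 0"
      using none by (intro sum.neutral) auto
    ultimately show False using c[OF v] by (simp add: functional_split)
  qed
  then have "is_hyperplane d h" unfolding is_hyperplane_def h_def by blast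
  moreover have "p ` S \<subseteq> h"
    using c S(1) in_space by (auto simp: h_def functional_split add_eq_0_iff2)
  ultimately show False using no_hyperplane[OF S] by blast
qed

text \<open>
  Affine extension of a barycentric coordinate to the whole space: the equation of the hyperplane
  through the other points.
\<close>

lemma barycentric_functional:
  assumes S: "S \<subseteq> V" "card S \<le> Suc d" and v: "v \<in> S"
  shows "\<exists>c. (\<Sum>i\<le>d. c i * coord i v) = 1 \<and> (\<forall>w\<in>S - {v}. (\<Sum>i\<le>d. c i * coord i w) = 0)"
proof -
  obtain B where B: "S \<subseteq> B" "B \<subseteq> V" "card B = Suc d"
    using exists_subset_between[OF S(2) card_V S(1) finite_V] by blast
  have finB: "finite B" using B(2) finite_V finite_subset by blast
  have "card (B - {v}) < card {..d}" using B v finB by (simp add: card_Diff_singleton subsetD)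
  then obtain c where c: "\<exists>i\<in>{..d}. c i \<noteq> 0" "\<forall>w\<in>B - {v}. (\<Sum>i\<le>d. c i * coord i w) = 0"
    using annihilating_functional_exists[of "B - {v}" "{..d}" coord] finB by auto
  define r where "r = (\<Sum>i\<le>d. c i * coord i v)"
  have "r \<noteq> 0"
  proof
    assume "r = 0"
    then have "(\<Sum>i\<le>d. c i * coord i w) = 0" if "w \<in> B" for w
      using c(2) that by (cases "w = v") (auto simp: r_def)
    then have "c i = 0" if "i \<le> d" for i using functional_vanish[OF B(2,3)] that by blast
    with c(1) show False by auto
  qed
  then have "(\<Sum>i\<le>d. c i / r * coord i v) = 1"
    by (simp add: r_def sum_divide_distrib[symmetric])
  moreover have "(\<Sum>i\<le>d. c i / r * coord i w) = 0" if "w \<in> S - {v}" for w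
    using c(2) B(1) that by (auto simp: sum_divide_distrib[symmetric])
  ultimately show ?thesis by (intro exI[of _ "\<lambda>i. c i / r"]) auto
qed

lemma dependence_trivial:
  assumes S: "S \<subseteq> V" "card S \<le> Suc d" and x: "dependence coord (Suc d) S x" and v: "v \<in> S"
  shows "x v = 0"
proof -
  obtain c where c: "(\<Sum>i\<le>d. c i * coord i v) = 1" "\<forall>w\<in>S - {v}. (\<Sum>i\<le>d. c i * coord i w) = 0"
    using barycentric_functional[OF S v] by blast
  have finS: "finite S" using S(1) finite_V finite_subset by blast
  have "(\<Sum>w\<in>S. x w * (\<Sum>i\<le>d. c i * coord i w)) = (\<Sum>w\<in>{v}. x w * (\<Sum>i\<le>d. c i * coord i w))"
    by (rule sum.mono_neutral_right) (use c finS v in auto)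
  then have "x v = (\<Sum>w\<in>S. x w * (\<Sum>i\<le>d. c i * coord i w))" using c(1) by simp
  also have "\<dots> = (\<Sum>w\<in>S. \<Sum>i\<le>d. c i * (x w * coord i w))"
    by (simp add: sum_distrib_left algebra_simps)
  also have "\<dots> = (\<Sum>i\<le>d. \<Sum>w\<in>S. c i * (x w * coord i w))" by (rule sum.swap)
  also have "\<dots> = (\<Sum>i\<le>d. c i * (\<Sum>w\<in>S. x w * coord i w))" by (simp add: sum_distrib_left)
  also have "\<dots> = 0" using x by (intro sum.neutral) (auto simp: dependence_def)
  finally show ?thesis .
qed

text \<open>
  The barycentric coordinates extend to continuous functions, so being positive is an open condition.
\<close>

lemma positive_combination_in_rel_interior:
  assumes S: "S \<subseteq> V" "card S \<le> Suc d" and u: "\<And>v. v \<in> S \<Longrightarrow> u v > 0" "sum u S = 1"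
  shows "(\<Sum>v\<in>S. u v *\<^sub>R p v) \<in> rel_interior (convex hull (p ` S))"
proof -
  have finS: "finite S" using S(1) finite_V finite_subset by blast
  have inj: "inj_on p S" using inj_p S(1) inj_on_subset by blast
  obtain c where c: "\<And>v. v \<in> S \<Longrightarrow> (\<Sum>i\<le>d. c v i * coord i v) = 1"
    "\<And>v w. v \<in> S \<Longrightarrow> w \<in> S \<Longrightarrow> w \<noteq> v \<Longrightarrow> (\<Sum>i\<le>d. c v i * coord i w) = 0"
  proof -
    have "\<forall>v\<in>S. \<exists>c. (\<Sum>i\<le>d. c i * coord i v) = 1 \<and> (\<forall>w\<in>S - {v}. (\<Sum>i\<le>d. c i * coord i w) = 0)"
      using barycentric_functional[OF S] by blast
    from bchoice[OF this] obtain c where "\<forall>v\<in>S. (\<Sum>i\<le>d. c v i * coord i v) = 1 \<and>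
      (\<forall>w\<in>S - {v}. (\<Sum>i\<le>d. c v i * coord i w) = 0)" by blast
    then show ?thesis by (intro that[of c]) simp_all
  qed
  define \<phi> where "\<phi> v y = (\<Sum>i<d. c v i * Poly_Mapping.lookup y i) + c v d" for v y
  have \<phi>_eq: "\<phi> v (\<Sum>w\<in>S. t w *\<^sub>R p w) = t v" if v: "v \<in> S" and t: "sum t S = 1" for v t
  proof -
    have "\<phi> v (\<Sum>w\<in>S. t w *\<^sub>R p w)
        = (\<Sum>i<d. \<Sum>w\<in>S. t w * (c v i * Poly_Mapping.lookup (p w) i)) + (\<Sum>w\<in>S. t w * c v d)"
      using t by (simp add: \<phi>_def lookup_sum lookup_scaleR sum_distrib_left sum_distrib_right[symmetric] algebra_simps)
    also have "(\<Sum>i<d. \<Sum>w\<in>S. t w * (c v i * Poly_Mapping.lookup (p w) i))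
        = (\<Sum>w\<in>S. \<Sum>i<d. t w * (c v i * Poly_Mapping.lookup (p w) i))" by (rule sum.swap)
    also have "\<dots> + (\<Sum>w\<in>S. t w * c v d) = (\<Sum>w\<in>S. t w * (\<Sum>i\<le>d. c v i * coord i w))"
      by (simp add: functional_split sum_distrib_left sum.distrib distrib_left)
    also have "\<dots> = (\<Sum>w\<in>{v}. t w * (\<Sum>i\<le>d. c v i * coord i w))"
      by (rule sum.mono_neutral_right) (use finS v c in auto)
    finally show ?thesis using c(1)[OF v] by simp
  qed
  \<comment> \<open>Intersected with the affine hull, this is the set of all strictly positive combinations.\<close>
  define T where "T = (\<Inter>v\<in>S. {y. \<phi> v y > 0})"
  have "open {y. \<phi> v y > 0}" for v
    unfolding \<phi>_def by (intro open_Collect_less continuous_intros continuous_lookup)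
  then have openT: "open T" unfolding T_def using finS by (intro open_INT) auto
  have hull: "\<exists>t. sum t S = 1 \<and> y = (\<Sum>w\<in>S. t w *\<^sub>R p w)" if y: "y \<in> affine hull (p ` S)" for y
  proof -
    obtain s where "sum s (p ` S) = 1" "(\<Sum>z\<in>p ` S. s z *\<^sub>R z) = y"
      using y finS by (auto simp: affine_hull_finite)
    then show ?thesis using inj by (intro exI[of _ "s \<circ> p"]) (simp add: sum.reindex)
  qed
  have in_hull: "(\<Sum>w\<in>S. t w *\<^sub>R p w) \<in> convex hull (p ` S)" if "\<And>v. v \<in> S \<Longrightarrow> t v \<ge> 0" "sum t S = 1" for t
    using finS that by (intro convex_sum) (auto intro: hull_inc)
  have "T \<inter> affine hull (p ` S) \<subseteq> convex hull (p ` S)"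
  proof
    fix y assume y: "y \<in> T \<inter> affine hull (p ` S)"
    then obtain t where t: "sum t S = 1" "y = (\<Sum>w\<in>S. t w *\<^sub>R p w)" using hull by blast
    have "t v \<ge> 0" if "v \<in> S" for v
    proof -
      have "\<phi> v y > 0" using y that by (auto simp: T_def)
      then show ?thesis using \<phi>_eq[OF that t(1)] t(2) by simp
    qed
    then show "y \<in> convex hull (p ` S)" using in_hull t by blast
  qed
  moreover have "(\<Sum>v\<in>S. u v *\<^sub>R p v) \<in> T" using \<phi>_eq u by (auto simp: T_def)
  moreover have "(\<Sum>v\<in>S. u v *\<^sub>R p v) \<in> convex hull (p ` S)"
    using u by (intro in_hull) (auto simp: less_imp_le)
  ultimately show ?thesis
    using openT unfolding mem_rel_interior affine_hull_convex_hull by blast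
qed

lemma strict_crossing:
  assumes e: "e \<subseteq> V" "card e \<le> Suc d" and f: "f \<subseteq> V" "card f \<le> Suc d"
    and ef: "e \<inter> f = {}" "e \<noteq> {}"
    and x: "dependence coord (Suc d) (e \<union> f) x" "\<And>v. v \<in> e \<Longrightarrow> x v > 0" "\<And>v. v \<in> f \<Longrightarrow> x v < 0"
  shows "crossing p e f"
proof -
  have fin: "finite e" "finite f" using e f finite_V finite_subset by blast+
  define t where "t = sum x e"
  have t: "t > 0" unfolding t_def using fin ef x(2) by (intro sum_pos) auto
  have cancel: "(\<Sum>v\<in>e. x v * coord i v) = (\<Sum>v\<in>f. - x v * coord i v)" if "i \<le> d" for i
  proof -
    have "(\<Sum>v\<in>e. x v * coord i v) + (\<Sum>v\<in>f. x v * coord i v) = 0"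
      using x(1) that ef(1) fin by (simp add: dependence_def sum.union_disjoint[symmetric])
    then show ?thesis by (simp add: sum_negf)
  qed
  have tf: "t = (\<Sum>v\<in>f. - x v)" using cancel[of d] by (simp add: t_def coord_def)
  have zero: "Poly_Mapping.lookup (p v) i = 0" if "v \<in> V" "\<not> i < d" for v i
    using in_space that by (force simp: real_space_def in_keys_iff)
  have lookup_eq: "Poly_Mapping.lookup (\<Sum>v\<in>S. (g v / t) *\<^sub>R p v) i
      = (\<Sum>v\<in>S. g v * Poly_Mapping.lookup (p v) i) / t" for S g i
    by (simp add: lookup_sum lookup_scaleR sum_divide_distrib)
  have "(\<Sum>v\<in>e. (x v / t) *\<^sub>R p v) = (\<Sum>v\<in>f. (- x v / t) *\<^sub>R p v)"
  proof (rule poly_mapping_eqI)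
    fix i
    have "(\<Sum>v\<in>e. x v * Poly_Mapping.lookup (p v) i) = (\<Sum>v\<in>f. - x v * Poly_Mapping.lookup (p v) i)"
    proof (cases "i < d")
      case True
      then show ?thesis using cancel[of i] by (simp add: coord_def)
    next
      case False
      then show ?thesis using zero e f by (simp add: subset_iff)
    qed
    then show "Poly_Mapping.lookup (\<Sum>v\<in>e. (x v / t) *\<^sub>R p v) i = Poly_Mapping.lookup (\<Sum>v\<in>f. (- x v / t) *\<^sub>R p v) i"
      by (simp only: lookup_eq)
  qed
  moreover have "(\<Sum>v\<in>e. (x v / t) *\<^sub>R p v) \<in> rel_interior (drawn_edge p e)"
    unfolding drawn_edge_def
    by (rule positive_combination_in_rel_interior[OF e])
      (use x t in \<open>auto simp: sum_divide_distrib[symmetric] t_def[symmetric]\<close>)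
  moreover have "(\<Sum>v\<in>f. (- x v / t) *\<^sub>R p v) \<in> rel_interior (drawn_edge p f)"
    unfolding drawn_edge_def
  proof (rule positive_combination_in_rel_interior[OF f])
    show "- x v / t > 0" if "v \<in> f" for v using x(3)[OF that] t by (simp add: divide_neg_pos)
    have "(\<Sum>v\<in>f. - x v / t) = (\<Sum>v\<in>f. - x v) / t" by (rule sum_divide_distrib[symmetric])
    then show "(\<Sum>v\<in>f. - x v / t) = 1" using t unfolding tf[symmetric] by simp
  qed
  ultimately show ?thesis using ef(1) unfolding crossing_def by auto
qed

text \<open>
  A nonzero dependence involves more than \<open>d + 1\<close> points, hence contains \<open>d + 1\<close> affinely independent ones. At
  each vertex \<open>u\<close> with coefficient zero one can then prescribe the wanted sign by a dependence supported
  on \<open>u\<close> and these \<open>d + 1\<close> points, and a small multiple of it does not change the other signs.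
\<close>

lemma weak_crossing:
  assumes e: "e \<subseteq> V" "card e \<le> Suc d" and f: "f \<subseteq> V" "card f \<le> Suc d" and ef: "e \<inter> f = {}" "e \<noteq> {}"
    and x: "dependence coord (Suc d) (e \<union> f) x" "\<And>v. v \<in> e \<Longrightarrow> x v \<ge> 0" "\<And>v. v \<in> f \<Longrightarrow> x v \<le> 0"
      "\<exists>v\<in>e \<union> f. x v \<noteq> 0"
  shows "crossing p e f"
proof -
  let ?A = "e \<union> f"
  have finA: "finite ?A" and A: "?A \<subseteq> V" using e f finite_V finite_subset by blast+
  define s where "s v = (if v \<in> e then 1 else - 1 :: real)" for v
  define N where "N = {v \<in> ?A. x v \<noteq> 0}"
  have finN: "finite N" "N \<subseteq> ?A" using finA by (auto simp: N_def)
  have "card N > Suc d"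
  proof (rule ccontr)
    assume "\<not> ?thesis"
    moreover have "dependence coord (Suc d) N x"
      using x(1) finA finN by (intro dependence_restrict[of coord "Suc d" ?A x N]) (auto simp: N_def)
    ultimately have "x v = 0" if "v \<in> N" for v
      using dependence_trivial[of N x v] finN A that by auto
    moreover from x(4) obtain v where "v \<in> N" by (auto simp: N_def)
    ultimately show False by (simp add: N_def)
  qed
  then obtain U where U: "U \<subseteq> N" "card U = Suc d"
    using exists_subset_between[of "{}" "Suc d" N] finN by auto
  have finU: "finite U" using U finN finite_subset by blast
  have "\<exists>y. dependence coord (Suc d) ?A y \<and> y u = s u \<and> (\<forall>v\<in>?A - insert u U. y v = 0)"
    if u: "u \<in> ?A - N" for u
  proof -
    have uU: "u \<notin> U" using u U by blast
    then have "Suc d < card (insert u U)" using U finU by simp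
    then obtain y' where y': "dependence coord (Suc d) (insert u U) y'" "\<exists>v\<in>insert u U. y' v \<noteq> 0"
      using dependence_exists[of "insert u U" "Suc d" coord] finU by auto
    have "y' u \<noteq> 0"
    proof
      assume 0: "y' u = 0"
      have "dependence coord (Suc d) U y'"
        using y'(1) finU 0 uU by (intro dependence_restrict[of coord "Suc d" "insert u U" y' U]) auto
      then have "y' v = 0" if "v \<in> U" for v
        using dependence_trivial[of U y' v] U finN A that by auto
      with y'(2) 0 show False by blast
    qed
    define y where "y v = (if v \<in> insert u U then s u / y' u * y' v + 0 * y' v else 0)" for v
    have "dependence coord (Suc d) (insert u U) (\<lambda>v. s u / y' u * y' v + 0 * y' v)"
      by (rule dependence_combination) (use y' in auto)
    moreover have "(\<Sum>v\<in>insert u U. y v * coord j v)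
        = (\<Sum>v\<in>insert u U. (s u / y' u * y' v + 0 * y' v) * coord j v)" for j
      by (rule sum.cong) (simp_all add: y_def)
    ultimately have "dependence coord (Suc d) (insert u U) y" by (simp add: dependence_def)
    then have "dependence coord (Suc d) ?A y"
      by (rule dependence_extend) (use finA u U finN in \<open>auto simp: y_def\<close>)
    moreover have "y u = s u" using \<open>y' u \<noteq> 0\<close> by (simp add: y_def)
    moreover have "\<forall>v\<in>?A - insert u U. y v = 0" by (simp add: y_def)
    ultimately show ?thesis by blast
  qed
  then obtain y where y: "\<And>u. u \<in> ?A - N \<Longrightarrow> dependence coord (Suc d) ?A (y u)"
    "\<And>u. u \<in> ?A - N \<Longrightarrow> y u u = s u" "\<And>u v. u \<in> ?A - N \<Longrightarrow> v \<in> ?A - insert u U \<Longrightarrow> y u v = 0"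
    by metis
  \<comment> \<open>Outside \<open>N\<close> the sum has the wanted signs, as the term of \<open>u\<close> vanishes at all other vertices outside \<open>N\<close>.\<close>
  define Y where "Y v = (\<Sum>u\<in>?A - N. y u v)" for v
  have "dependence coord (Suc d) ?A Y"
    unfolding dependence_def
  proof (intro allI impI)
    fix j assume j: "j < Suc d"
    have "(\<Sum>v\<in>?A. Y v * coord j v) = (\<Sum>v\<in>?A. \<Sum>u\<in>?A - N. y u v * coord j v)"
      by (simp add: Y_def sum_distrib_right)
    also have "\<dots> = (\<Sum>u\<in>?A - N. \<Sum>v\<in>?A. y u v * coord j v)" by (rule sum.swap)
    also have "\<dots> = 0"
      by (rule sum.neutral) (use y(1) j in \<open>simp add: dependence_def\<close>)
    finally show "(\<Sum>v\<in>?A. Y v * coord j v) = 0" .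
  qed
  have YZ: "Y v = s v" if v: "v \<in> ?A - N" for v
  proof -
    have "Y v = (\<Sum>u\<in>{v}. y u v)"
      unfolding Y_def by (rule sum.mono_neutral_right) (use finA v y(3) U in auto)
    with y(2)[OF v] show ?thesis by simp
  qed
  have sx: "s v * x v > 0" if "v \<in> N" for v
    using that x(2,3)[of v] by (auto simp: s_def N_def less_le)
  have "\<forall>\<^sub>F t in at_right (0::real). \<forall>v\<in>N. s v * (x v + t * Y v) > 0"
  proof (intro eventually_ball_finite finN ballI)
    fix v assume v: "v \<in> N"
    have "((\<lambda>t. s v * (x v + t * Y v)) \<longlongrightarrow> s v * (x v + 0 * Y v)) (at_right 0)"
      by (intro tendsto_intros)
    with sx[OF v] show "\<forall>\<^sub>F t in at_right 0. s v * (x v + t * Y v) > 0"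
      by (intro order_tendstoD(1)[of _ "s v * x v"]) simp_all
  qed
  moreover have "\<forall>\<^sub>F t in at_right (0::real). t > 0" by (rule eventually_at_right_less)
  ultimately have "\<forall>\<^sub>F t in at_right (0::real). t > 0 \<and> (\<forall>v\<in>N. s v * (x v + t * Y v) > 0)"
    by eventually_elim simp
  then obtain t :: real where t: "t > 0" "\<forall>v\<in>N. s v * (x v + t * Y v) > 0"
    using eventually_happens'[OF trivial_limit_at_right_real] by blast
  define z where "z v = 1 * x v + t * Y v" for v
  have sz: "s v * z v > 0" if "v \<in> ?A" for v
  proof (cases "v \<in> N")
    case True
    with t(2) show ?thesis by (simp add: z_def)
  next
    case False
    then have "x v = 0" "Y v = s v" using that YZ by (auto simp: N_def)
    with t(1) show ?thesis by (simp add: z_def s_def)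
  qed
  show ?thesis
  proof (rule strict_crossing[OF e f ef])
    show "dependence coord (Suc d) ?A z"
      unfolding z_def by (rule dependence_combination) fact+
    show "z v > 0" if "v \<in> e" for v using sz[of v] that by (simp add: s_def)
    show "z v < 0" if "v \<in> f" for v
    proof -
      have "v \<notin> e" using that ef(1) by blast
      with sz[of v] that show ?thesis by (simp add: s_def)
    qed
  qed
qed

end

section \<open>Crossing pairs in complete balanced hypergraphs\<close>

definition transversal :: "nat \<Rightarrow> (nat \<Rightarrow> nat) \<Rightarrow> (nat \<times> nat) set" where
  "transversal d a = (\<lambda>i. (i, a i)) ` {..<d}"

definition pairs :: "nat \<Rightarrow> (nat \<times> nat) set" where
  "pairs n = (SIGMA a:{..<n}. {..<n} - {a})"

lemma mem_pairs: "x \<in> pairs n \<longleftrightarrow> fst x < n \<and> snd x < n \<and> fst x \<noteq> snd x"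
  by (cases x) (auto simp: pairs_def)

lemma finite_pairs: "finite (pairs n)"
  by (simp add: pairs_def)

lemma card_pairs: "card (pairs n) = n * (n - 1)"
  by (simp add: pairs_def)

lemma hverts_complete_partite: "hverts (complete_partite_hypergraph d n) = {..<d} \<times> {..<n}"
  by (auto simp: complete_partite_hypergraph_def partite_part_def Let_def)

lemma uniform_complete_partite: "uniform_hypergraph d (complete_partite_hypergraph d n)"
  by (auto simp: uniform_hypergraph_def complete_partite_hypergraph_def Let_def)

lemma card_transversal: "card (transversal d a) = d"
  unfolding transversal_def by (subst card_image) (auto simp: inj_on_def)

lemma transversal_edge:
  assumes "\<And>i. i < d \<Longrightarrow> a i < n"
  shows "transversal d a \<in> hedges (complete_partite_hypergraph d n)"
proof -
  have "transversal d a \<inter> partite_part n i = {(i, a i)}" if "i < d" for i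
    using assms that by (auto simp: transversal_def partite_part_def)
  moreover have "transversal d a \<subseteq> (\<Union>i<d. partite_part n i)"
    using assms by (auto simp: transversal_def partite_part_def)
  ultimately show ?thesis
    using card_transversal by (simp add: complete_partite_hypergraph_def Let_def)
qed

lemma transversal_eqD: "transversal d a = transversal d b \<Longrightarrow> i < d \<Longrightarrow> a i = b i"
  by (auto simp: transversal_def)

lemma sum_transversal: "sum F (transversal d a) = (\<Sum>i<d. F (i, a i))"
  unfolding transversal_def by (subst sum.reindex) (auto simp: inj_on_def)

lemma transversal_disjoint: "(\<And>i. i < d \<Longrightarrow> a i \<noteq> b i) \<Longrightarrow> transversal d a \<inter> transversal d b = {}"
  by (auto simp: transversal_def)

lemma drawing_general_position:
  assumes dr: "rectilinear_drawing d (complete_partite_hypergraph d n) p" and d: "d > 0" and n: "n \<ge> 2"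
  shows "general_position d p ({..<d} \<times> {..<n})"
proof
  have "Suc d \<le> d * 2" using d by simp
  also have "\<dots> \<le> d * n" using n by simp
  finally show "Suc d \<le> card ({..<d} \<times> {..<n})" by simp
qed (use dr d in \<open>auto simp: rectilinear_drawing_def hverts_complete_partite\<close>)

lemma triple_signs:
  fixes q :: "nat \<Rightarrow> real"
  assumes "\<And>a b. a < 3 \<Longrightarrow> b < 3 \<Longrightarrow> a \<noteq> b \<Longrightarrow> \<not> (q a > 0 \<and> q b > 0) \<and> \<not> (q a < 0 \<and> q b < 0)"
  shows "\<exists>a b. a < 3 \<and> b < 3 \<and> a \<noteq> b \<and> q a \<ge> 0 \<and> q b \<le> 0 \<and> (\<forall>k<3. k \<noteq> a \<longrightarrow> k \<noteq> b \<longrightarrow> q k = 0)"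
proof -
  have other: "\<exists>b<3. b \<noteq> a" for a :: nat by (rule exI[of _ "if a = 0 then 1 else 0"]) simp
  consider a b where "a < 3" "b < 3" "q a > 0" "q b < 0"
    | a where "a < 3" "q a > 0" "\<forall>k<3. q k \<ge> 0"
    | b where "b < 3" "q b < 0" "\<forall>k<3. q k \<le> 0"
    | "\<forall>k<3. q k = 0"
    by (meson linorder_not_less order_antisym)
  then show ?thesis
  proof cases
    case (1 a b)
    then have "q k = 0" if "k < 3" "k \<noteq> a" "k \<noteq> b" for k
      using assms[of k a] assms[of k b] that by force
    moreover have "a \<noteq> b" using 1 by auto
    ultimately show ?thesis using 1 by (intro exI[of _ a] exI[of _ b]) auto
  next
    case (2 a)
    then have z: "q k = 0" if "k < 3" "k \<noteq> a" for k
      using assms[of k a] that by force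
    from other obtain b where "b < 3" "b \<noteq> a" by blast
    with 2 z show ?thesis by (intro exI[of _ a] exI[of _ b]) auto
  next
    case (3 b)
    then have z: "q k = 0" if "k < 3" "k \<noteq> b" for k
      using assms[of k b] that by force
    from other obtain a where "a < 3" "a \<noteq> b" by blast
    with 3 z show ?thesis by (intro exI[of _ a] exI[of _ b]) auto
  next
    case 4
    then show ?thesis by (intro exI[of _ 0] exI[of _ 1]) auto
  qed
qed

text \<open>
  The functionals fed into \<open>crossing_dependence\<close> are the \<open>d + 1\<close> homogeneous coordinates of the three
  points chosen in each of the first \<open>m\<close> parts. A vertex outside these parts gets coefficient zero, which
  is compatible with both signs; therefore \<open>h\<close> is free there.
\<close>

lemma crossing_selection:
  assumes dr: "rectilinear_drawing d (complete_partite_hypergraph d n) p" and d: "d > 0" and n: "n \<ge> 2"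
    and m: "m \<le> d" "Suc d \<le> 2 * m - 1"
    and T: "\<And>i. i < m \<Longrightarrow> T i \<subseteq> {..<n} \<and> card (T i) = 3"
  shows "\<exists>g. (\<forall>i<m. fst (g i) \<in> T i \<and> snd (g i) \<in> T i \<and> fst (g i) \<noteq> snd (g i)) \<and>
    (\<forall>h. (\<forall>i<d. h i \<in> pairs n) \<longrightarrow> (\<forall>i<m. h i = g i) \<longrightarrow>
      crossing p (transversal d (fst \<circ> h)) (transversal d (snd \<circ> h)))"
proof -
  interpret general_position d p "{..<d} \<times> {..<n}"
    by (rule drawing_general_position[OF dr d n])
  have "\<exists>f. bij_betw f {..<3::nat} (T i)" if "i < m" for i
  proof -
    have "finite (T i)" "card (T i) = 3" using T[OF that] finite_subset by auto
    then show ?thesis using ex_bij_betw_nat_finite[of "T i"] by (simp add: atLeast0LessThan)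
  qed
  then obtain \<tau> where \<tau>: "\<And>i. i < m \<Longrightarrow> bij_betw (\<tau> i) {..<3::nat} (T i)" by metis
  define L where "L j v = coord j (fst v, \<tau> (fst v) (snd v))" for j v
  obtain y where y: "\<exists>v\<in>{..<m} \<times> {..<3}. y v \<noteq> 0" "dependence L (Suc d) ({..<m} \<times> {..<3}) y"
    "crossing_pattern m y"
  proof -
    have "m > 0" using m(2) by (cases m) auto
    from crossing_dependence[OF this m(2), of L] show ?thesis using that by blast
  qed
  have "\<exists>c. fst c < 3 \<and> snd c < 3 \<and> fst c \<noteq> snd c \<and> y (i, fst c) \<ge> 0 \<and> y (i, snd c) \<le> 0 \<and>
     (\<forall>k<3. k \<noteq> fst c \<longrightarrow> k \<noteq> snd c \<longrightarrow> y (i, k) = 0)" if i: "i < m" for i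
  proof -
    obtain a b where "a < 3 \<and> b < 3 \<and> a \<noteq> b \<and> y (i, a) \<ge> 0 \<and> y (i, b) \<le> 0 \<and>
      (\<forall>k<3. k \<noteq> a \<longrightarrow> k \<noteq> b \<longrightarrow> y (i, k) = 0)"
      using triple_signs[of "\<lambda>k. y (i, k)"] y(3) i by (auto simp: crossing_pattern_def)
    then show ?thesis by (intro exI[of _ "(a, b)"]) simp
  qed
  then obtain c where c: "\<And>i. i < m \<Longrightarrow> fst (c i) < 3 \<and> snd (c i) < 3 \<and> fst (c i) \<noteq> snd (c i) \<and>
      y (i, fst (c i)) \<ge> 0 \<and> y (i, snd (c i)) \<le> 0 \<and>
      (\<forall>k<3. k \<noteq> fst (c i) \<longrightarrow> k \<noteq> snd (c i) \<longrightarrow> y (i, k) = 0)"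
    by metis
  define g where "g i = (\<tau> i (fst (c i)), \<tau> i (snd (c i)))" for i
  \<comment> \<open>The coefficients of \<open>y\<close>, carried over to the vertices; \<open>c i\<close> names the positive and the negative index.\<close>
  define x where "x v = (if fst v < m then
      (if snd v = fst (g (fst v)) then y (fst v, fst (c (fst v)))
       else if snd v = snd (g (fst v)) then y (fst v, snd (c (fst v))) else 0) else 0)" for v
  have g_T: "fst (g i) \<in> T i \<and> snd (g i) \<in> T i" if "i < m" for i
    using \<tau>[OF that] c[OF that] by (auto simp: g_def bij_betw_def)
  have g_ne: "fst (g i) \<noteq> snd (g i)" if "i < m" for i
    using \<tau>[OF that] c[OF that] by (auto simp: g_def bij_betw_def inj_on_def)
  have x_fst: "x (i, fst (g i)) = y (i, fst (c i))" if "i < m" for i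
    using that by (simp add: x_def)
  have x_snd: "x (i, snd (g i)) = y (i, snd (c i))" if "i < m" for i
    using that g_ne[OF that] by (simp add: x_def)
  have x_out: "x (i, k) = 0" if "\<not> i < m" for i k
    using that by (simp add: x_def)
  have "crossing p (transversal d (fst \<circ> h)) (transversal d (snd \<circ> h))"
    if h: "\<forall>i<d. h i \<in> pairs n" "\<forall>i<m. h i = g i" for h
  proof (rule weak_crossing[where x = x])
    let ?e = "transversal d (fst \<circ> h)" and ?f = "transversal d (snd \<circ> h)"
    show sub: "?e \<subseteq> {..<d} \<times> {..<n}" "?f \<subseteq> {..<d} \<times> {..<n}"
      using h(1) by (auto simp: transversal_def mem_pairs)
    show "card ?e \<le> Suc d" "card ?f \<le> Suc d" by (simp_all add: card_transversal)
    show disj: "?e \<inter> ?f = {}"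
      by (rule transversal_disjoint) (use h(1) in \<open>auto simp: mem_pairs\<close>)
    show "?e \<noteq> {}" using d card_transversal[of d "fst \<circ> h"] by auto
    show "x v \<ge> 0" if v: "v \<in> ?e" for v
    proof -
      obtain i where i: "v = (i, fst (h i))" using v by (auto simp: transversal_def)
      show ?thesis using i h(2) c x_fst x_out by (cases "i < m") auto
    qed
    show "x v \<le> 0" if v: "v \<in> ?f" for v
    proof -
      obtain i where i: "v = (i, snd (h i))" using v by (auto simp: transversal_def)
      show ?thesis using i h(2) c x_snd x_out by (cases "i < m") auto
    qed
    show "\<exists>v\<in>?e \<union> ?f. x v \<noteq> 0"
    proof -
      obtain i k where ik: "i < m" "k < 3" "y (i, k) \<noteq> 0" using y(1) by auto
      then have "k = fst (c i) \<or> k = snd (c i)" using c by blast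
      then have "x (i, fst (g i)) \<noteq> 0 \<or> x (i, snd (g i)) \<noteq> 0"
        using ik x_fst x_snd by auto
      moreover have "(i, fst (g i)) \<in> ?e" "(i, snd (g i)) \<in> ?f"
        using ik(1) m h(2) by (auto simp: transversal_def)
      ultimately show ?thesis by blast
    qed
    show "dependence coord (Suc d) (?e \<union> ?f) x"
      unfolding dependence_def
    proof (intro allI impI)
      fix j assume j: "j < Suc d"
      have restrict: "(\<Sum>i<d. x (i, r i) * coord j (i, r i)) = (\<Sum>i<m. x (i, r i) * coord j (i, r i))" for r
        by (rule sum.mono_neutral_right) (use m x_out in auto)
      have "(\<Sum>v\<in>?e \<union> ?f. x v * coord j v) = (\<Sum>v\<in>?e. x v * coord j v) + (\<Sum>v\<in>?f. x v * coord j v)"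
        by (rule sum.union_disjoint) (use disj in \<open>auto simp: transversal_def\<close>)
      also have "\<dots> = (\<Sum>i<m. x (i, fst (h i)) * coord j (i, fst (h i)) + x (i, snd (h i)) * coord j (i, snd (h i)))"
        by (simp add: sum_transversal restrict sum.distrib)
      also have "\<dots> = (\<Sum>i<m. \<Sum>k<3. y (i, k) * L j (i, k))"
      proof (rule sum.cong)
        fix i assume "i \<in> {..<m}"
        then have i: "i < m" by simp
        have "(\<Sum>k<3. y (i, k) * L j (i, k)) = (\<Sum>k\<in>{fst (c i), snd (c i)}. y (i, k) * L j (i, k))"
          by (rule sum.mono_neutral_right) (use c[OF i] in auto)
        also have "\<dots> = y (i, fst (c i)) * L j (i, fst (c i)) + y (i, snd (c i)) * L j (i, snd (c i))"
          using c[OF i] by simp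
        finally show "x (i, fst (h i)) * coord j (i, fst (h i)) + x (i, snd (h i)) * coord j (i, snd (h i))
            = (\<Sum>k<3. y (i, k) * L j (i, k))"
          using i h(2) x_fst[OF i] x_snd[OF i] by (simp add: L_def g_def)
      qed simp
      also have "\<dots> = (\<Sum>v\<in>{..<m} \<times> {..<3}. y v * L j v)"
        by (simp add: sum.cartesian_product case_prod_unfold)
      also have "\<dots> = 0" using y(2) j by (simp add: dependence_def)
      finally show "(\<Sum>v\<in>?e \<union> ?f. x v * coord j v) = 0" .
    qed
  qed
  with g_T g_ne show ?thesis by (intro exI[of _ g]) simp
qed

section \<open>Counting crossing pairs\<close>

lemma card_triples_containing:
  assumes "a < n" "b < n" "a \<noteq> b"
  shows "card {T. T \<subseteq> {..<n} \<and> card T = 3 \<and> a \<in> T \<and> b \<in> T} \<le> n - 2"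
proof -
  have "{T. T \<subseteq> {..<n} \<and> card T = 3 \<and> a \<in> T \<and> b \<in> T} \<subseteq> (\<lambda>c. {a, b, c}) ` ({..<n} - {a, b})"
  proof
    fix T assume "T \<in> {T. T \<subseteq> {..<n} \<and> card T = 3 \<and> a \<in> T \<and> b \<in> T}"
    then have T: "T \<subseteq> {..<n}" "card T = 3" "a \<in> T" "b \<in> T" by auto
    then have "card (T - {a, b}) = 1" using assms by (subst card_Diff_subset) auto
    then obtain c where c: "T - {a, b} = {c}" by (auto simp: card_1_singleton_iff)
    then have "T = {a, b, c}" "c \<in> {..<n} - {a, b}" using T by auto
    then show "T \<in> (\<lambda>c. {a, b, c}) ` ({..<n} - {a, b})" by blast
  qed
  then have "card {T. T \<subseteq> {..<n} \<and> card T = 3 \<and> a \<in> T \<and> b \<in> T} \<le> card ({..<n} - {a, b})"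
    by (meson card_image_le card_mono finite_Diff finite_imageI finite_lessThan order_trans)
  also have "\<dots> = n - 2" using assms by (subst card_Diff_subset) auto
  finally show ?thesis .
qed

text \<open>
  Ordered crossing pairs of edges; \<open>h i\<close> consists of the vertices of both edges in part \<open>i\<close>.
\<close>

definition crossing_choices :: "nat \<Rightarrow> nat \<Rightarrow> (nat \<times> nat \<Rightarrow> (nat \<Rightarrow>\<^sub>0 real)) \<Rightarrow> (nat \<Rightarrow> nat \<times> nat) set" where
  "crossing_choices d n p = {h \<in> {..<d} \<rightarrow>\<^sub>E pairs n.
     crossing p (transversal d (fst \<circ> h)) (transversal d (snd \<circ> h))}"

lemma finite_crossing_choices: "finite (crossing_choices d n p)"
  unfolding crossing_choices_def
  by (rule finite_subset[of _ "{..<d} \<rightarrow>\<^sub>E pairs n"]) (auto intro!: finite_PiE finite_pairs)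

lemma card_le_fibres:
  assumes "finite B" "\<And>x. x \<in> A \<Longrightarrow> f x \<in> B" "\<And>b. b \<in> B \<Longrightarrow> card {x \<in> A. f x = b} \<le> k"
  shows "card A \<le> card B * k"
proof -
  have "A = (\<Union>b\<in>B. {x \<in> A. f x = b})" using assms(2) by auto
  then have "card A \<le> (\<Sum>b\<in>B. card {x \<in> A. f x = b})"
    using card_UN_le[OF assms(1), of "\<lambda>b. {x \<in> A. f x = b}"] by simp
  also have "\<dots> \<le> card B * k" using sum_bounded_above[of B _ k] assms(3) by simp
  finally show ?thesis .
qed

text \<open>
  Each system of triples on the first \<open>m\<close> parts, combined with arbitrary pairs on the other parts, yields
  a crossing pair \<open>h\<close>. For given \<open>h\<close>, the pairs on the other parts are determined, and each triple
  contains the pair chosen by \<open>h\<close> in its part.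
\<close>

lemma card_crossing_choices:
  assumes dr: "rectilinear_drawing d (complete_partite_hypergraph d n) p" and d: "d > 0" and n: "n \<ge> 2"
    and m: "m \<le> d" "Suc d \<le> 2 * m - 1"
  shows "(n choose 3) ^ m * (n * (n - 1)) ^ (d - m) \<le> card (crossing_choices d n p) * (n - 2) ^ m"
proof -
  define Q where "Q = {T. T \<subseteq> {..<n} \<and> card T = 3}"
  define A where "A = ({..<m} \<rightarrow>\<^sub>E Q) \<times> ({m..<d} \<rightarrow>\<^sub>E pairs n)"
  have finQ: "finite Q" unfolding Q_def by (rule finite_subset[of _ "Pow {..<n}"]) auto
  have "card Q = n choose 3" unfolding Q_def using n_subsets[of "{..<n}" 3] by simp
  then have card_A: "card A = (n choose 3) ^ m * (n * (n - 1)) ^ (d - m)"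
    by (simp add: A_def card_cartesian_product card_PiE card_pairs)
  have "\<forall>T\<in>{..<m} \<rightarrow>\<^sub>E Q. \<exists>g. (\<forall>i<m. fst (g i) \<in> T i \<and> snd (g i) \<in> T i \<and> fst (g i) \<noteq> snd (g i)) \<and>
    (\<forall>h. (\<forall>i<d. h i \<in> pairs n) \<longrightarrow> (\<forall>i<m. h i = g i) \<longrightarrow>
      crossing p (transversal d (fst \<circ> h)) (transversal d (snd \<circ> h)))"
    by (intro ballI crossing_selection[OF dr d n m]) (auto simp: Q_def PiE_iff)
  from bchoice[OF this] obtain G where G: "\<forall>T\<in>{..<m} \<rightarrow>\<^sub>E Q.
    (\<forall>i<m. fst (G T i) \<in> T i \<and> snd (G T i) \<in> T i \<and> fst (G T i) \<noteq> snd (G T i)) \<and>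
    (\<forall>h. (\<forall>i<d. h i \<in> pairs n) \<longrightarrow> (\<forall>i<m. h i = G T i) \<longrightarrow>
      crossing p (transversal d (fst \<circ> h)) (transversal d (snd \<circ> h)))" by blast
  define \<Phi> where "\<Phi> = (\<lambda>(T, r). \<lambda>i\<in>{..<d}. if i < m then G T i else r i)"
  have "card A \<le> card (crossing_choices d n p) * (n - 2) ^ m"
  proof (rule card_le_fibres[OF finite_crossing_choices])
    fix Tr assume "Tr \<in> A"
    then obtain T r where Tr: "Tr = (T, r)" and T: "T \<in> {..<m} \<rightarrow>\<^sub>E Q" and r: "r \<in> {m..<d} \<rightarrow>\<^sub>E pairs n"
      by (auto simp: A_def)
    have "G T i \<in> pairs n" if "i < m" for i
    proof -
      have "T i \<in> Q" using T that by auto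
      then show ?thesis using G T that by (force simp: Q_def mem_pairs)
    qed
    then have \<Phi>: "\<Phi> Tr i \<in> pairs n" if "i < d" for i
      using that r by (auto simp: Tr \<Phi>_def PiE_iff)
    moreover have "\<forall>i<m. \<Phi> Tr i = G T i" using m by (simp add: Tr \<Phi>_def)
    ultimately have "crossing p (transversal d (fst \<circ> \<Phi> Tr)) (transversal d (snd \<circ> \<Phi> Tr))"
      using G T by blast
    moreover have "\<Phi> Tr \<in> {..<d} \<rightarrow>\<^sub>E pairs n"
      using \<Phi> by (auto simp: PiE_iff extensional_def) (simp add: Tr \<Phi>_def)
    ultimately show "\<Phi> Tr \<in> crossing_choices d n p" by (simp add: crossing_choices_def)
  next
    fix h assume "h \<in> crossing_choices d n p"
    then have h: "h i \<in> pairs n" if "i < d" for i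
      using that by (auto simp: crossing_choices_def)
    define B where "B i = {T. T \<subseteq> {..<n} \<and> card T = 3 \<and> fst (h i) \<in> T \<and> snd (h i) \<in> T}" for i
    have finB: "finite (B i)" for i
      unfolding B_def by (rule finite_subset[of _ "Pow {..<n}"]) auto
    have "{Tr \<in> A. \<Phi> Tr = h} \<subseteq> (PiE {..<m} B) \<times> {restrict h {m..<d}}"
    proof
      fix Tr assume "Tr \<in> {Tr \<in> A. \<Phi> Tr = h}"
      then obtain T r where Tr: "Tr = (T, r)" and T: "T \<in> {..<m} \<rightarrow>\<^sub>E Q"
        and r: "r \<in> {m..<d} \<rightarrow>\<^sub>E pairs n" and \<Phi>: "\<Phi> (T, r) = h"
        by (auto simp: A_def)
      have "T i \<in> B i" if i: "i < m" for i
      proof -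
        have "h i = G T i" using i m by (simp add: \<Phi>[symmetric] \<Phi>_def)
        moreover have "T i \<in> Q" using T i by auto
        ultimately show ?thesis using G T i by (simp add: B_def Q_def)
      qed
      then have "T \<in> PiE {..<m} B" using T by (auto simp: PiE_iff)
      moreover have "r = restrict h {m..<d}"
        using r by (auto simp: \<Phi>[symmetric] \<Phi>_def PiE_iff extensional_def fun_eq_iff)
      ultimately show "Tr \<in> (PiE {..<m} B) \<times> {restrict h {m..<d}}" by (simp add: Tr)
    qed
    then have "card {Tr \<in> A. \<Phi> Tr = h} \<le> card ((PiE {..<m} B) \<times> {restrict h {m..<d}})"
      by (intro card_mono) (auto intro!: finite_PiE finB)
    also have "\<dots> = (\<Prod>i<m. card (B i))" by (simp add: card_cartesian_product card_PiE)
    also have "\<dots> \<le> (\<Prod>i<m. n - 2)"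
    proof (rule prod_mono)
      fix i assume "i \<in> {..<m}"
      then have "i < d" using m by simp
      from h[OF this] show "0 \<le> card (B i) \<and> card (B i) \<le> n - 2"
        unfolding B_def by (auto simp: mem_pairs intro: card_triples_containing)
    qed
    finally show "card {Tr \<in> A. \<Phi> Tr = h} \<le> (n - 2) ^ m" by simp
  qed
  then show ?thesis by (simp add: card_A)
qed

text \<open>
  An unordered crossing pair comes from at most two ordered ones.
\<close>

lemma crossing_choices_le:
  "card (crossing_choices d n p) \<le> card (crossing_pairs (complete_partite_hypergraph d n) p) * 2"
proof (rule card_le_fibres)
  let ?H = "complete_partite_hypergraph d n"
  let ?e = "\<lambda>h. transversal d (fst \<circ> h)" and ?f = "\<lambda>h. transversal d (snd \<circ> h)"
  have "e \<subseteq> {..<d} \<times> {..<n}" if "e \<in> hedges ?H" for e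
    using uniform_complete_partite[of d n] that
    by (simp add: uniform_hypergraph_def hverts_complete_partite)
  then have "crossing_pairs ?H p \<subseteq> Pow (Pow ({..<d} \<times> {..<n}))"
    unfolding crossing_pairs_def by blast
  then show "finite (crossing_pairs ?H p)" by (rule finite_subset) simp
  fix h assume h: "h \<in> crossing_choices d n p"
  then have "h i \<in> pairs n" if "i < d" for i using that by (auto simp: crossing_choices_def)
  then have "?e h \<in> hedges ?H" "?f h \<in> hedges ?H" by (auto intro!: transversal_edge simp: mem_pairs)
  with h show "{?e h, ?f h} \<in> crossing_pairs ?H p"
    unfolding crossing_pairs_def crossing_choices_def by blast
next
  let ?e = "\<lambda>h. transversal d (fst \<circ> h)" and ?f = "\<lambda>h. transversal d (snd \<circ> h)"
  fix P assume "P \<in> crossing_pairs (complete_partite_hypergraph d n) p"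
  then obtain e f where P: "P = {e, f}" by (auto simp: crossing_pairs_def)
  let ?F = "{h \<in> crossing_choices d n p. {?e h, ?f h} = P}"
  have "inj_on ?e ?F"
  proof (rule inj_onI)
    fix h h' assume h: "h \<in> ?F" "h' \<in> ?F" and e: "?e h = ?e h'"
    then have "{?e h, ?f h} = {?e h, ?f h'}" by simp
    then have f: "?f h = ?f h'" by (auto simp: doubleton_eq_iff)
    have "h i = h' i" if "i < d" for i
      using transversal_eqD[OF e that] transversal_eqD[OF f that] by (simp add: prod_eq_iff)
    moreover have "h \<in> {..<d} \<rightarrow>\<^sub>E pairs n" "h' \<in> {..<d} \<rightarrow>\<^sub>E pairs n"
      using h by (auto simp: crossing_choices_def)
    ultimately show "h = h'" by (intro PiE_ext) auto
  qed
  then have "card ?F = card (?e ` ?F)" by (simp add: card_image)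
  also have "\<dots> \<le> card {e, f}" by (rule card_mono) (auto simp: P)
  also have "\<dots> \<le> 2" by (simp add: card_insert_if)
  finally show "card ?F \<le> 2" .
qed

text \<open>
  Points on the moment curve. It makes the infimum that defines the crossing number one over a
  nonempty set; otherwise the infimum would be \<open>0\<close>.
\<close>

lemma drawing_exists:
  assumes d: "d > 0"
  shows "\<exists>p. rectilinear_drawing d (complete_partite_hypergraph d n) p"
proof -
  define t where "t v = real (prod_encode v)" for v
  have inj_t: "inj t" unfolding t_def by (metis injI of_nat_eq_iff prod_encode_inverse)
  define p where "p v = Abs_poly_mapping (\<lambda>j. if j < d then t v ^ Suc j else 0)" for v
  have lookup_p: "Poly_Mapping.lookup (p v) j = (if j < d then t v ^ Suc j else 0)" for v j
    unfolding p_def by (subst lookup_Abs_poly_mapping) (auto intro: finite_subset[of _ "{..<d}"])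
  have "p v \<in> real_space d" for v
    by (auto simp: real_space_def in_keys_iff lookup_p split: if_splits)
  moreover have "inj p"
  proof (rule injI)
    fix u v assume "p u = p v"
    then have "Poly_Mapping.lookup (p u) 0 = Poly_Mapping.lookup (p v) 0" by simp
    then show "u = v" using d inj_t by (simp add: lookup_p inj_eq)
  qed
  moreover have "\<not> p ` S \<subseteq> h" if S: "card S = d + 1" and hyp: "is_hyperplane d h" for S h
  proof
    assume sub: "p ` S \<subseteq> h"
    obtain a b where a: "\<exists>i<d. a i \<noteq> 0"
      and h: "h = {x \<in> real_space d. (\<Sum>i<d. a i * Poly_Mapping.lookup x i) = b}"
      using hyp unfolding is_hyperplane_def by blast
    \<comment> \<open>The parameters of points on the hyperplane are roots of the polynomial with coefficients \<open>c\<close>.\<close>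
    define c where "c i = (case i of 0 \<Rightarrow> - b | Suc j \<Rightarrow> a j)" for i
    obtain i where i: "i < d" "a i \<noteq> 0" using a by blast
    let ?R = "{z. (\<Sum>i\<le>d. c i * z ^ i) = 0}"
    have "c (Suc i) \<noteq> 0" "Suc i \<le> d" using i by (simp_all add: c_def)
    then have "\<exists>k. k \<le> d \<and> c k \<noteq> 0" by blast
    then have R: "finite ?R \<and> card ?R \<le> d" by (rule polyfun_rootbound)
    have "t ` S \<subseteq> ?R"
    proof
      fix z assume "z \<in> t ` S"
      then obtain v where v: "v \<in> S" "z = t v" by blast
      then have "(\<Sum>i<d. a i * t v ^ Suc i) = b" using sub by (auto simp: h lookup_p)
      then show "z \<in> ?R" unfolding sum.atMost_shift by (simp add: c_def v)
    qed
    then have "card (t ` S) \<le> card ?R" using R by (intro card_mono) blast+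
    with R have "card (t ` S) \<le> d" by linarith
    moreover have "card (t ` S) = card S" by (rule card_image) (rule inj_on_subset[OF inj_t subset_UNIV])
    ultimately show False using S by simp
  qed
  ultimately show ?thesis
    unfolding rectilinear_drawing_def using uniform_complete_partite
    by (intro exI[of _ p]) (auto intro: inj_on_subset)
qed

lemma choose_three: "6 * (n choose 3) = n * (n - 1) * (n - 2)"
proof -
  have three: "3 * (n choose 3) = n * ((n - 1) choose 2)"
    using times_binomial_minus1_eq[of 3 n] by simp
  have two: "2 * ((n - 1) choose 2) = (n - 1) * (n - 2)"
    using times_binomial_minus1_eq[of 2 "n - 1"] by (simp add: numeral_2_eq_2)
  have "6 * (n choose 3) = 2 * (3 * (n choose 3))" by simp
  also have "\<dots> = n * (2 * ((n - 1) choose 2))" by (simp only: three mult.left_commute)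
  finally show ?thesis by (simp only: two mult.assoc)
qed

lemma crossing_number_bound:
  assumes d: "d \<ge> 3" and n: "n \<ge> 3" and m: "m = (d + 1) div 2 + 1"
  shows "(n * (n - 1)) ^ d \<le> 2 * 6 ^ m * rectilinear_crossing_number d (complete_partite_hypergraph d n)"
proof -
  let ?H = "complete_partite_hypergraph d n"
  let ?K = "rectilinear_crossing_number d ?H"
  have md: "m \<le> d" "Suc d \<le> 2 * m - 1" using d m by linarith+
  have "{card (crossing_pairs ?H p) | p. rectilinear_drawing d ?H p} \<noteq> {}"
    using drawing_exists[of d n] d by auto
  then have "?K \<in> {card (crossing_pairs ?H p) | p. rectilinear_drawing d ?H p}"
    unfolding rectilinear_crossing_number_def by (rule Inf_nat_def1)
  then obtain p where p: "rectilinear_drawing d ?H p" "?K = card (crossing_pairs ?H p)" by blast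
  have "(n choose 3) ^ m * (n * (n - 1)) ^ (d - m) \<le> card (crossing_choices d n p) * (n - 2) ^ m"
    by (rule card_crossing_choices[OF p(1) _ _ md]) (use d n in auto)
  also have "\<dots> \<le> (?K * 2) * (n - 2) ^ m"
    unfolding p(2) by (intro mult_right_mono crossing_choices_le) simp
  finally have le: "6 ^ m * ((n choose 3) ^ m * (n * (n - 1)) ^ (d - m)) \<le> 6 ^ m * ((?K * 2) * (n - 2) ^ m)"
    by (rule mult_left_mono) simp
  have six: "6 ^ m * (n choose 3) ^ m = (n * (n - 1)) ^ m * (n - 2) ^ m"
    by (simp add: power_mult_distrib[symmetric] choose_three)
  have "6 ^ m * ((n choose 3) ^ m * (n * (n - 1)) ^ (d - m)) =
      (6 ^ m * (n choose 3) ^ m) * (n * (n - 1)) ^ (d - m)"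
    by (simp only: mult.assoc)
  also have "\<dots> = ((n * (n - 1)) ^ m * (n * (n - 1)) ^ (d - m)) * (n - 2) ^ m"
    by (simp only: six mult_ac)
  also have "(n * (n - 1)) ^ m * (n * (n - 1)) ^ (d - m) = (n * (n - 1)) ^ d"
    using md by (simp add: power_add[symmetric])
  finally have eq: "6 ^ m * ((n choose 3) ^ m * (n * (n - 1)) ^ (d - m)) = (n * (n - 1)) ^ d * (n - 2) ^ m" .
  from le have "(n * (n - 1)) ^ d * (n - 2) ^ m \<le> (2 * 6 ^ m * ?K) * (n - 2) ^ m"
    unfolding eq by (simp only: mult_ac)
  then show ?thesis using n by simp
qed

theorem mainTheorem1:
  shows "\<exists>c::real. c > 0 \<and> (\<exists>d\<^sub>0::nat. \<forall>d\<ge>d\<^sub>0. \<forall>n::nat. n \<ge> 3 \<longrightarrow>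
    real (rectilinear_crossing_number d (complete_partite_hypergraph d n)) \<ge>
      c * (8 / 3) powr (real d / 2) * (real n / 2) ^ d * ((real n - 1) / 2) ^ d)"
proof (intro exI[of _ "1 / 72"] conjI exI[of _ 3] allI impI)
  fix d n :: nat assume d: "d \<ge> 3" and n: "n \<ge> 3"
  define m where "m = (d + 1) div 2 + 1"
  define K where "K = rectilinear_crossing_number d (complete_partite_hypergraph d n)"
  define A where "A = (real n * (real n - 1)) ^ d"
  have "real ((n * (n - 1)) ^ d) \<le> real (2 * 6 ^ m * K)"
    unfolding K_def using crossing_number_bound[OF d n m_def] by (rule of_nat_mono)
  then have AK: "A \<le> 2 * 6 ^ m * real K" using n by (simp add: A_def)
  \<comment> \<open>The rounding in \<open>m\<close> costs at most a factor \<open>6 ^ 2\<close>; another factor 2 comes from ordering the pairs.\<close>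
  have "(6::real) ^ m = 6 powr real m" by (simp add: powr_realpow)
  also have "\<dots> \<le> 6 powr (real d / 2 + 2)" by (rule powr_mono) (simp_all add: m_def)
  also have "\<dots> = 36 * 6 powr (real d / 2)" by (simp add: powr_add)
  finally have m6: "(6::real) ^ m \<le> 36 * 6 powr (real d / 2)" .
  have "(4::real) ^ d = 16 powr (real d / 2)"
  proof -
    have "(16::real) = 4 powr 2" by simp
    then have "16 powr (real d / 2) = (4::real) powr (2 * (real d / 2))" by (simp only: powr_powr)
    then show ?thesis by (simp add: powr_realpow)
  qed
  moreover have "(real n / 2) ^ d * ((real n - 1) / 2) ^ d = A / 4 ^ d"
    by (simp add: A_def power_mult_distrib[symmetric] power_divide[symmetric])
  ultimately have "(8 / 3) powr (real d / 2) * ((real n / 2) ^ d * ((real n - 1) / 2) ^ d)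
      = ((8 / 3) powr (real d / 2) / 16 powr (real d / 2)) * A" by simp
  also have "(8 / 3) powr (real d / 2) / 16 powr (real d / 2) = (1 / 6 :: real) powr (real d / 2)"
    by (subst powr_divide[symmetric]) simp_all
  also have "\<dots> = 1 / 6 powr (real d / 2)" by (simp add: powr_divide)
  finally have target: "(8 / 3) powr (real d / 2) * ((real n / 2) ^ d * ((real n - 1) / 2) ^ d)
      = A / 6 powr (real d / 2)" by simp
  have "A \<le> 2 * (36 * 6 powr (real d / 2)) * real K"
  proof -
    have "2 * 6 ^ m * real K \<le> 2 * (36 * 6 powr (real d / 2)) * real K"
      using m6 by (intro mult_right_mono) auto
    with AK show ?thesis by linarith
  qed
  then have "1 / 72 * (A / 6 powr (real d / 2)) \<le> real K" by (simp add: field_simps)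
  then show "real (rectilinear_crossing_number d (complete_partite_hypergraph d n)) \<ge>
      1 / 72 * (8 / 3) powr (real d / 2) * (real n / 2) ^ d * ((real n - 1) / 2) ^ d"
    unfolding K_def[symmetric] target[symmetric] by (simp only: mult.assoc)
qed simp

end
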